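(* (Work in $\mathsf{ZFC}$.) Let $\mathcal S$ be a countable vocabulary of function and predicate symbols of finite arity containing $=,\neq,\in,\notin$, let $T$ be a set of $\Sigma(L_{\omega\omega}(\mathcal S))$ conditionals, and let $\chi\Rightarrow\chi'$ be a $\Sigma(L_{\omega\omega}(\mathcal S))$ conditional. Then either $\chi\Rightarrow\chi'$ has a finitary positivistic proof from the axioms of $T$ together with the logical axioms (P1)–(P23) below, or there is an admissible structure modelling every conditional of $T$ in which $\chi\Rightarrow\chi'$ fails for some tuple of elements. Logical axioms (no distinction between free and bound variables; $x,y,z$ are variables, $\phi,\psi,\chi$ arbitrary $\Sigma$ formulas): (P1) $\phi\Rightarrow\top$; (P2) $\bot\Rightarrow\psi$; (P3) $\phi\wedge\psi\Rightarrow\phi$; (P4) $\phi\wedge\psi\Rightarrow\psi$; (P5) $\phi\Rightarrow\phi\wedge\phi$; (P6) $\phi\Rightarrow\phi\vee\psi$; (P7) $\psi\Rightarrow\phi\vee\psi$; (P8) $\psi\vee\psi\Rightarrow\psi$; (P9) $(\phi\vee\psi)\wedge\chi\Rightarrow(\phi\wedge\chi)\vee(\psi\wedge\chi)$; (P10) $\phi\Rightarrow\exists x\,\phi$; (P11) $\exists y\,\psi\Rightarrow\psi$ for $y$ not free in $\psi$; (P12) $\chi\wedge\exists y\,\phi\Rightarrow\exists y\,(\chi\wedge\phi)$ for $y$ not free in $\chi$; (P13) $x\in z\wedge\forall x\in z\,\phi\Rightarrow\phi$; (P14) $\psi\Rightarrow\forall y\in z\,(\psi\wedge y\in z)$ for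 $y$ not free in $\psi$; (P15) $\forall y\in z\,(\chi\vee\phi)\Rightarrow\chi\vee\forall y\in z\,\phi$ for $y$ not free in $\chi$; (P16) $\top\Rightarrow x\in y\vee x\notin y$; (P17) $x\in y\wedge x\notin y\Rightarrow\bot$; (P18) $\top\Rightarrow x=y\vee x\neq y$; (P19) $x=y\wedge x\neq y\Rightarrow\bot$; (P20) $\top\Rightarrow x=x$; (P21) $x=y\Rightarrow y=x$; (P22) $x=y\wedge y=z\Rightarrow x=z$; (P23) $x=y\wedge\phi^z_x\Rightarrow\phi^z_y$ for $x,y$ substitutable for $z$ in $\phi$.
   Context: $\Sigma(L_{\omega\omega}(\mathcal S))$ formulas: built from atomic formulas of $\mathcal S$ (including $\top,\bot$; $\neq,\notin$ are primitive predicate symbols) using binary $\wedge$, binary $\vee$, bounded universal quantification $\forall x\in t\,\phi$, and unbounded existential quantification $\exists x\,\phi$; no negation or implication. A conditional is an expression $\phi\Rightarrow\psi$ with $\phi,\psi$ $\Sigma$ formulas. An application of a conditional $\phi(v_1,\dots,v_n)\Rightarrow\psi(v_1,\dots,v_n)$ (with $v_1,\dots,v_n$ its free variables) is a pair $(\chi_0,\chi_1)$ of $\Sigma$ formulas such that $\chi_1$ is obtained from $\chi_0$ by replacing one occurrence of a subformula of the form $\phi(t_1,\dots,t_n)$ by $\psi(t_1,\dots,t_n)$ (substitution of the $t_i$ for the free occurrences of the $v_i$), where the terms $t_i$ may contain variables bound in $\chi_0$. A finitary positivistic proof of $\chi\Rightarrow\chi'$ from a set of axioms (conditionals) is a finite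 sequence $\chi=\chi_0,\dots,\chi_n=\chi'$ of $\Sigma$ formulas with each $(\chi_i,\chi_{i+1})$ an application of some axiom. An admissible structure interprets $=$ as true equality, $\neq$ as its complement, and $\notin$ as the complement of $\in$. A structure models a conditional if it satisfies the universal closure of $\phi\to\psi$. *)

theory Defs
  imports "HOL-Library.Countable"
begin

datatype 'f trm = Var nat | Fn 'f "'f trm list"

datatype 'p pred = PEq | PNeq | PIn | PNotin | PSym 'p

datatype ('f, 'p) fm =
    Top
  | Bot
  | Atom "'p pred" "'f trm list"
  | Conj "('f, 'p) fm" "('f, 'p) fm"
  | Disj "('f, 'p) fm" "('f, 'p) fm"
  | BAll nat "'f trm" "('f, 'p) fm"
  | Ex nat "('f, 'p) fm"

primrec pred_arity :: "('p \<Rightarrow> nat) \<Rightarrow> 'p pred \<Rightarrow> nat" where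
  "pred_arity PA PEq = 2"
| "pred_arity PA PNeq = 2"
| "pred_arity PA PIn = 2"
| "pred_arity PA PNotin = 2"
| "pred_arity PA (PSym p) = PA p"

primrec twf :: "('f \<Rightarrow> nat) \<Rightarrow> 'f trm \<Rightarrow> bool" where
  "twf FA (Var x) = True"
| "twf FA (Fn f ts) = (length ts = FA f \<and> list_all (twf FA) ts)"

primrec fwf :: "('f \<Rightarrow> nat) \<Rightarrow> ('p \<Rightarrow> nat) \<Rightarrow> ('f, 'p) fm \<Rightarrow> bool" where
  "fwf FA PA Top = True"
| "fwf FA PA Bot = True"
| "fwf FA PA (Atom p ts) = (length ts = pred_arity PA p \<and> list_all (twf FA) ts)"
| "fwf FA PA (Conj \<phi> \<psi>) = (fwf FA PA \<phi> \<and> fwf FA PA \<psi>)"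
| "fwf FA PA (Disj \<phi> \<psi>) = (fwf FA PA \<phi> \<and> fwf FA PA \<psi>)"
| "fwf FA PA (BAll x t \<phi>) = (twf FA t \<and> fwf FA PA \<phi>)"
| "fwf FA PA (Ex x \<phi>) = fwf FA PA \<phi>"

primrec tvars :: "'f trm \<Rightarrow> nat set" where
  "tvars (Var x) = {x}"
| "tvars (Fn f ts) = \<Union> (set (map tvars ts))"

primrec fv :: "('f, 'p) fm \<Rightarrow> nat set" where
  "fv Top = {}"
| "fv Bot = {}"
| "fv (Atom p ts) = \<Union> (set (map tvars ts))"
| "fv (Conj \<phi> \<psi>) = fv \<phi> \<union> fv \<psi>"
| "fv (Disj \<phi> \<psi>) = fv \<phi> \<union> fv \<psi>"
| "fv (BAll x t \<phi>) = tvars t \<union> (fv \<phi> - {x})"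
| "fv (Ex x \<phi>) = fv \<phi> - {x}"

primrec tsubst :: "(nat \<Rightarrow> 'f trm) \<Rightarrow> 'f trm \<Rightarrow> 'f trm" where
  "tsubst \<sigma> (Var x) = \<sigma> x"
| "tsubst \<sigma> (Fn f ts) = Fn f (map (tsubst \<sigma>) ts)"

primrec subst :: "(nat \<Rightarrow> 'f trm) \<Rightarrow> ('f, 'p) fm \<Rightarrow> ('f, 'p) fm" where
  "subst \<sigma> Top = Top"
| "subst \<sigma> Bot = Bot"
| "subst \<sigma> (Atom p ts) = Atom p (map (tsubst \<sigma>) ts)"
| "subst \<sigma> (Conj \<phi> \<psi>) = Conj (subst \<sigma> \<phi>) (subst \<sigma> \<psi>)"
| "subst \<sigma> (Disj \<phi> \<psi>) = Disj (subst \<sigma> \<phi>) (subst \<sigma> \<psi>)"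
| "subst \<sigma> (BAll x t \<phi>) = BAll x (tsubst \<sigma> t) (subst (\<sigma>(x := Var x)) \<phi>)"
| "subst \<sigma> (Ex x \<phi>) = Ex x (subst (\<sigma>(x := Var x)) \<phi>)"

primrec substble :: "(nat \<Rightarrow> 'f trm) \<Rightarrow> ('f, 'p) fm \<Rightarrow> bool" where
  "substble \<sigma> Top = True"
| "substble \<sigma> Bot = True"
| "substble \<sigma> (Atom p ts) = True"
| "substble \<sigma> (Conj \<phi> \<psi>) = (substble \<sigma> \<phi> \<and> substble \<sigma> \<psi>)"
| "substble \<sigma> (Disj \<phi> \<psi>) = (substble \<sigma> \<phi> \<and> substble \<sigma> \<psi>)"
| "substble \<sigma> (BAll x t \<phi>) =
     (substble (\<sigma>(x := Var x)) \<phi> \<and> (\<forall>v \<in> fv \<phi> - {x}. x \<notin> tvars (\<sigma> v)))"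
| "substble \<sigma> (Ex x \<phi>) =
     (substble (\<sigma>(x := Var x)) \<phi> \<and> (\<forall>v \<in> fv \<phi> - {x}. x \<notin> tvars (\<sigma> v)))"

datatype ('f, 'p) ctx =
    Hole
  | CConjL "('f, 'p) ctx" "('f, 'p) fm"
  | CConjR "('f, 'p) fm" "('f, 'p) ctx"
  | CDisjL "('f, 'p) ctx" "('f, 'p) fm"
  | CDisjR "('f, 'p) fm" "('f, 'p) ctx"
  | CBAll nat "'f trm" "('f, 'p) ctx"
  | CEx nat "('f, 'p) ctx"

primrec plug :: "('f, 'p) ctx \<Rightarrow> ('f, 'p) fm \<Rightarrow> ('f, 'p) fm" where
  "plug Hole \<theta> = \<theta>"
| "plug (CConjL C \<psi>) \<theta> = Conj (plug C \<theta>) \<psi>"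
| "plug (CConjR \<phi> C) \<theta> = Conj \<phi> (plug C \<theta>)"
| "plug (CDisjL C \<psi>) \<theta> = Disj (plug C \<theta>) \<psi>"
| "plug (CDisjR \<phi> C) \<theta> = Disj \<phi> (plug C \<theta>)"
| "plug (CBAll x t C) \<theta> = BAll x t (plug C \<theta>)"
| "plug (CEx x C) \<theta> = Ex x (plug C \<theta>)"

type_synonym ('f, 'p) cond = "('f, 'p) fm \<times> ('f, 'p) fm"

definition application :: "('f, 'p) cond \<Rightarrow> ('f, 'p) fm \<Rightarrow> ('f, 'p) fm \<Rightarrow> bool" where
  "application c \<chi>0 \<chi>1 \<longleftrightarrow>
     (\<exists>C \<sigma>. substble \<sigma> (fst c) \<and> substble \<sigma> (snd c) \<and>
            \<chi>0 = plug C (subst \<sigma> (fst c)) \<and> \<chi>1 = plug C (subst \<sigma> (snd c)))"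

abbreviation vIn :: "nat \<Rightarrow> nat \<Rightarrow> ('f, 'p) fm" where
  "vIn x y \<equiv> Atom PIn [Var x, Var y]"
abbreviation vNotin :: "nat \<Rightarrow> nat \<Rightarrow> ('f, 'p) fm" where
  "vNotin x y \<equiv> Atom PNotin [Var x, Var y]"
abbreviation vEq :: "nat \<Rightarrow> nat \<Rightarrow> ('f, 'p) fm" where
  "vEq x y \<equiv> Atom PEq [Var x, Var y]"
abbreviation vNeq :: "nat \<Rightarrow> nat \<Rightarrow> ('f, 'p) fm" where
  "vNeq x y \<equiv> Atom PNeq [Var x, Var y]"

inductive_set logax :: "('f \<Rightarrow> nat) \<Rightarrow> ('p \<Rightarrow> nat) \<Rightarrow> ('f, 'p) cond set"
  for FA PA where
  P1: "fwf FA PA \<phi> \<Longrightarrow> (\<phi>, Top) \<in> logax FA PA"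
| P2: "fwf FA PA \<psi> \<Longrightarrow> (Bot, \<psi>) \<in> logax FA PA"
| P3: "fwf FA PA \<phi> \<Longrightarrow> fwf FA PA \<psi> \<Longrightarrow> (Conj \<phi> \<psi>, \<phi>) \<in> logax FA PA"
| P4: "fwf FA PA \<phi> \<Longrightarrow> fwf FA PA \<psi> \<Longrightarrow> (Conj \<phi> \<psi>, \<psi>) \<in> logax FA PA"
| P5: "fwf FA PA \<phi> \<Longrightarrow> (\<phi>, Conj \<phi> \<phi>) \<in> logax FA PA"
| P6: "fwf FA PA \<phi> \<Longrightarrow> fwf FA PA \<psi> \<Longrightarrow> (\<phi>, Disj \<phi> \<psi>) \<in> logax FA PA"
| P7: "fwf FA PA \<phi> \<Longrightarrow> fwf FA PA \<psi> \<Longrightarrow> (\<psi>, Disj \<phi> \<psi>) \<in> logax FA PA"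
| P8: "fwf FA PA \<psi> \<Longrightarrow> (Disj \<psi> \<psi>, \<psi>) \<in> logax FA PA"
| P9: "fwf FA PA \<phi> \<Longrightarrow> fwf FA PA \<psi> \<Longrightarrow> fwf FA PA \<chi> \<Longrightarrow>
       (Conj (Disj \<phi> \<psi>) \<chi>, Disj (Conj \<phi> \<chi>) (Conj \<psi> \<chi>)) \<in> logax FA PA"
| P10: "fwf FA PA \<phi> \<Longrightarrow> (\<phi>, Ex x \<phi>) \<in> logax FA PA"
| P11: "fwf FA PA \<psi> \<Longrightarrow> y \<notin> fv \<psi> \<Longrightarrow> (Ex y \<psi>, \<psi>) \<in> logax FA PA"
| P12: "fwf FA PA \<chi> \<Longrightarrow> fwf FA PA \<phi> \<Longrightarrow> y \<notin> fv \<chi> \<Longrightarrow>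
        (Conj \<chi> (Ex y \<phi>), Ex y (Conj \<chi> \<phi>)) \<in> logax FA PA"
| P13: "fwf FA PA \<phi> \<Longrightarrow> (Conj (vIn x z) (BAll x (Var z) \<phi>), \<phi>) \<in> logax FA PA"
| P14: "fwf FA PA \<psi> \<Longrightarrow> y \<notin> fv \<psi> \<Longrightarrow>
        (\<psi>, BAll y (Var z) (Conj \<psi> (vIn y z))) \<in> logax FA PA"
| P15: "fwf FA PA \<chi> \<Longrightarrow> fwf FA PA \<phi> \<Longrightarrow> y \<notin> fv \<chi> \<Longrightarrow>
        (BAll y (Var z) (Disj \<chi> \<phi>), Disj \<chi> (BAll y (Var z) \<phi>)) \<in> logax FA PA"
| P16: "(Top, Disj (vIn x y) (vNotin x y)) \<in> logax FA PA"
| P17: "(Conj (vIn x y) (vNotin x y), Bot) \<in> logax FA PA"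
| P18: "(Top, Disj (vEq x y) (vNeq x y)) \<in> logax FA PA"
| P19: "(Conj (vEq x y) (vNeq x y), Bot) \<in> logax FA PA"
| P20: "(Top, vEq x x) \<in> logax FA PA"
| P21: "(vEq x y, vEq y x) \<in> logax FA PA"
| P22: "(Conj (vEq x y) (vEq y z), vEq x z) \<in> logax FA PA"
| P23: "fwf FA PA \<phi> \<Longrightarrow> substble (Var(z := Var x)) \<phi> \<Longrightarrow> substble (Var(z := Var y)) \<phi> \<Longrightarrow>
        (Conj (vEq x y) (subst (Var(z := Var x)) \<phi>), subst (Var(z := Var y)) \<phi>) \<in> logax FA PA"

definition fp_proof ::
  "('f \<Rightarrow> nat) \<Rightarrow> ('p \<Rightarrow> nat) \<Rightarrow> ('f, 'p) cond set \<Rightarrow> ('f, 'p) fm list \<Rightarrow> ('f, 'p) fm \<Rightarrow> ('f, 'p) fm \<Rightarrow> bool"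
  where
  "fp_proof FA PA T xs \<chi> \<chi>' \<longleftrightarrow>
     xs \<noteq> [] \<and> hd xs = \<chi> \<and> last xs = \<chi>' \<and> list_all (fwf FA PA) xs \<and>
     (\<forall>i. Suc i < length xs \<longrightarrow>
        (\<exists>c \<in> T \<union> logax FA PA. application c (xs ! i) (xs ! Suc i)))"

definition fp_provable ::
  "('f \<Rightarrow> nat) \<Rightarrow> ('p \<Rightarrow> nat) \<Rightarrow> ('f, 'p) cond set \<Rightarrow> ('f, 'p) fm \<Rightarrow> ('f, 'p) fm \<Rightarrow> bool"
  where
  "fp_provable FA PA T \<chi> \<chi>' \<longleftrightarrow> (\<exists>xs. fp_proof FA PA T xs \<chi> \<chi>')"

datatype ('f, 'p) struc =
  Struc (dom: "nat set") (fint: "'f \<Rightarrow> nat list \<Rightarrow> nat") (pint: "'p pred \<Rightarrow> nat list \<Rightarrow> bool")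

definition is_structure :: "('f \<Rightarrow> nat) \<Rightarrow> ('f, 'p) struc \<Rightarrow> bool" where
  "is_structure FA M \<longleftrightarrow> dom M \<noteq> {} \<and>
     (\<forall>f as. length as = FA f \<longrightarrow> set as \<subseteq> dom M \<longrightarrow> fint M f as \<in> dom M)"

definition admissible :: "('f \<Rightarrow> nat) \<Rightarrow> ('f, 'p) struc \<Rightarrow> bool" where
  "admissible FA M \<longleftrightarrow> is_structure FA M \<and>
     (\<forall>a \<in> dom M. \<forall>b \<in> dom M.
        (pint M PEq [a, b] \<longleftrightarrow> a = b) \<and>
        (pint M PNeq [a, b] \<longleftrightarrow> a \<noteq> b) \<and>
        (pint M PNotin [a, b] \<longleftrightarrow> \<not> pint M PIn [a, b]))"

primrec teval :: "('f, 'p) struc \<Rightarrow> (nat \<Rightarrow> nat) \<Rightarrow> 'f trm \<Rightarrow> nat" where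
  "teval M e (Var x) = e x"
| "teval M e (Fn f ts) = fint M f (map (teval M e) ts)"

primrec sat :: "('f, 'p) struc \<Rightarrow> (nat \<Rightarrow> nat) \<Rightarrow> ('f, 'p) fm \<Rightarrow> bool" where
  "sat M e Top = True"
| "sat M e Bot = False"
| "sat M e (Atom p ts) = pint M p (map (teval M e) ts)"
| "sat M e (Conj \<phi> \<psi>) = (sat M e \<phi> \<and> sat M e \<psi>)"
| "sat M e (Disj \<phi> \<psi>) = (sat M e \<phi> \<or> sat M e \<psi>)"
| "sat M e (BAll x t \<phi>) =
     (\<forall>a \<in> dom M. pint M PIn [a, teval M e t] \<longrightarrow> sat M (e(x := a)) \<phi>)"
| "sat M e (Ex x \<phi>) = (\<exists>a \<in> dom M. sat M (e(x := a)) \<phi>)"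

definition assignment :: "('f, 'p) struc \<Rightarrow> (nat \<Rightarrow> nat) \<Rightarrow> bool" where
  "assignment M e \<longleftrightarrow> range e \<subseteq> dom M"

definition models_cond :: "('f, 'p) struc \<Rightarrow> ('f, 'p) cond \<Rightarrow> bool" where
  "models_cond M c \<longleftrightarrow> (\<forall>e. assignment M e \<longrightarrow> sat M e (fst c) \<longrightarrow> sat M e (snd c))"

end

(* If \<chi> \<Rightarrow> \<chi>' is not derivable, a Henkin construction enumerates all formulas and grows a
   pair (F, G), starting from ({\<chi>}, {\<chi>'}), that stays consistent: no finite conjunction of
   members of F derives a finite disjunction of members of G.  A formula joins F when this is
   possible and otherwise G, which keeps consistency by the cut rule obtained from P5 and the
   distributivity axiom P9; an existential joining F brings a fresh witness, a bounded universal
   joining G a fresh counterexample.  In the limit every well-formed formula lies in exactly one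
   of the two sides, and the term model whose elements are the classes of variables modulo the
   equations of F satisfies precisely the formulas of F.  As the conditionals of T are closed
   under substitution, F is closed under them, so the model satisfies T but not \<chi> \<Rightarrow> \<chi>'. *)

theory Submission
  imports Defs
begin

instance trm :: (countable) countable by countable_datatype
instance pred :: (countable) countable by countable_datatype
instance fm :: (countable, countable) countable by countable_datatype

primrec bv :: "('f, 'p) fm \<Rightarrow> nat set" where
  "bv Top = {}"
| "bv Bot = {}"
| "bv (Atom p ts) = {}"
| "bv (Conj \<phi> \<psi>) = bv \<phi> \<union> bv \<psi>"
| "bv (Disj \<phi> \<psi>) = bv \<phi> \<union> bv \<psi>"
| "bv (BAll x t \<phi>) = insert x (bv \<phi>)"
| "bv (Ex x \<phi>) = insert x (bv \<phi>)"

lemma finite_tvars [simp]: "finite (tvars t)"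
  by (induction t) auto

lemma finite_fv [simp]: "finite (fv \<phi>)"
  by (induction \<phi>) auto

lemma finite_bv [simp]: "finite (bv \<phi>)"
  by (induction \<phi>) auto

lemma ex_fresh_var: "finite (S :: nat set) \<Longrightarrow> \<exists>x. x \<notin> S"
  using infinite_UNIV_nat by (meson ex_new_if_finite)

lemma tsubst_cong: "(\<And>v. v \<in> tvars t \<Longrightarrow> \<sigma> v = \<sigma>' v) \<Longrightarrow> tsubst \<sigma> t = tsubst \<sigma>' t"
  by (induction t) auto

lemma tsubst_Var [simp]: "tsubst Var t = t"
  by (induction t) (auto simp: map_idI)

lemma tsubst_upd_fresh: "z \<notin> tvars t \<Longrightarrow> tsubst (Var(z := s)) t = t"
  by (induction t) (auto simp: map_idI)

lemma tvars_tsubst: "tvars (tsubst \<sigma> t) = (\<Union>v\<in>tvars t. tvars (\<sigma> v))"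
  by (induction t) auto

lemma tsubst_tsubst: "tsubst \<sigma> (tsubst \<tau> t) = tsubst (\<lambda>v. tsubst \<sigma> (\<tau> v)) t"
  by (induction t) auto

lemma twf_tsubst: "twf FA t \<Longrightarrow> (\<And>v. twf FA (\<sigma> v)) \<Longrightarrow> twf FA (tsubst \<sigma> t)"
  by (induction t) (auto simp: list_all_iff)

lemma subst_cong: "(\<And>v. v \<in> fv \<phi> \<Longrightarrow> \<sigma> v = \<sigma>' v) \<Longrightarrow> subst \<sigma> \<phi> = subst \<sigma>' \<phi>"
proof (induction \<phi> arbitrary: \<sigma> \<sigma>')
  case (Atom p ts)
  have "map (tsubst \<sigma>) ts = map (tsubst \<sigma>') ts"
  proof (rule map_cong[OF refl], rule tsubst_cong)
    fix t v assume "t \<in> set ts" "v \<in> tvars t"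
    then show "\<sigma> v = \<sigma>' v" using Atom by auto
  qed
  then show ?case by simp
next
  case (BAll x t \<phi>)
  have "subst (\<sigma>(x := Var x)) \<phi> = subst (\<sigma>'(x := Var x)) \<phi>" by (rule BAll.IH) (use BAll.prems in auto)
  moreover have "tsubst \<sigma> t = tsubst \<sigma>' t" by (rule tsubst_cong) (use BAll.prems in auto)
  ultimately show ?case by simp
next
  case (Ex x \<phi>)
  have "subst (\<sigma>(x := Var x)) \<phi> = subst (\<sigma>'(x := Var x)) \<phi>" by (rule Ex.IH) (use Ex.prems in auto)
  then show ?case by simp
next
  case (Conj a b)
  have "subst \<sigma> a = subst \<sigma>' a" by (rule Conj.IH(1)) (use Conj.prems in simp)
  moreover have "subst \<sigma> b = subst \<sigma>' b" by (rule Conj.IH(2)) (use Conj.prems in simp)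
  ultimately show ?case by simp
next
  case (Disj a b)
  have "subst \<sigma> a = subst \<sigma>' a" by (rule Disj.IH(1)) (use Disj.prems in simp)
  moreover have "subst \<sigma> b = subst \<sigma>' b" by (rule Disj.IH(2)) (use Disj.prems in simp)
  ultimately show ?case by simp
qed simp_all

lemma substble_cong: "(\<And>v. v \<in> fv \<phi> \<Longrightarrow> \<sigma> v = \<sigma>' v) \<Longrightarrow> substble \<sigma> \<phi> = substble \<sigma>' \<phi>"
proof (induction \<phi> arbitrary: \<sigma> \<sigma>')
  case (Conj \<phi> \<psi>)
  have "substble \<sigma> \<phi> = substble \<sigma>' \<phi>" "substble \<sigma> \<psi> = substble \<sigma>' \<psi>"
    by (rule Conj.IH; use Conj.prems in simp)+
  then show ?case by simp
next
  case (Disj \<phi> \<psi>)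
  have "substble \<sigma> \<phi> = substble \<sigma>' \<phi>" "substble \<sigma> \<psi> = substble \<sigma>' \<psi>"
    by (rule Disj.IH; use Disj.prems in simp)+
  then show ?case by simp
next
  case (BAll x t \<phi>)
  have "substble (\<sigma>(x := Var x)) \<phi> = substble (\<sigma>'(x := Var x)) \<phi>"
    by (rule BAll.IH) (use BAll.prems in auto)
  then show ?case using BAll.prems by simp
next
  case (Ex x \<phi>)
  have "substble (\<sigma>(x := Var x)) \<phi> = substble (\<sigma>'(x := Var x)) \<phi>"
    by (rule Ex.IH) (use Ex.prems in auto)
  then show ?case using Ex.prems by simp
qed simp_all

lemma Var_upd_Var [simp]: "Var(x := Var x) = Var"
  by auto

lemma Var_upd_upd_Var [simp]: "y \<noteq> z \<Longrightarrow> (Var(z := s))(y := Var y) = Var(z := s)"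
  by auto

lemma subst_Var [simp]: "subst Var \<phi> = \<phi>"
  by (induction \<phi>) (simp_all add: map_idI)

lemma substble_Var [simp]: "substble Var \<phi>"
  by (induction \<phi>) simp_all

lemma subst_upd_fresh: "z \<notin> fv \<phi> \<Longrightarrow> subst (Var(z := s)) \<phi> = \<phi>"
  using subst_cong[of \<phi> "Var(z := s)" Var] by (metis fun_upd_other subst_Var)

lemma substble_upd_fresh: "z \<notin> fv \<phi> \<Longrightarrow> substble (Var(z := s)) \<phi>"
  using substble_cong[of \<phi> "Var(z := s)" Var] by (metis fun_upd_other substble_Var)

lemma bv_subst [simp]: "bv (subst \<sigma> \<phi>) = bv \<phi>"
  by (induction \<phi> arbitrary: \<sigma>) simp_all

lemma fwf_subst: "fwf FA PA \<phi> \<Longrightarrow> (\<And>v. twf FA (\<sigma> v)) \<Longrightarrow> fwf FA PA (subst \<sigma> \<phi>)"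
  by (induction \<phi> arbitrary: \<sigma>) (auto simp: list_all_iff intro: twf_tsubst)

lemma fv_subst_subset: "fv (subst \<sigma> \<phi>) \<subseteq> (\<Union>v\<in>fv \<phi>. tvars (\<sigma> v))"
proof (induction \<phi> arbitrary: \<sigma>)
  case (Atom p ts) then show ?case by (auto simp: tvars_tsubst)
next
  case (Conj a b) then show ?case by (simp, blast)
next
  case (Disj a b) then show ?case by (simp, blast)
next
  case (BAll x t \<phi>)
  have "fv (subst (\<sigma>(x := Var x)) \<phi>) \<subseteq> (\<Union>v\<in>fv \<phi>. tvars ((\<sigma>(x := Var x)) v))" by (rule BAll.IH)
  then show ?case by (auto simp: tvars_tsubst split: if_splits)
next
  case (Ex x \<phi>)
  have "fv (subst (\<sigma>(x := Var x)) \<phi>) \<subseteq> (\<Union>v\<in>fv \<phi>. tvars ((\<sigma>(x := Var x)) v))" by (rule Ex.IH)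
  then show ?case by (auto split: if_splits)
qed simp_all

lemma fv_subst: "substble \<sigma> \<phi> \<Longrightarrow> fv (subst \<sigma> \<phi>) = (\<Union>v\<in>fv \<phi>. tvars (\<sigma> v))"
proof (induction \<phi> arbitrary: \<sigma>)
  case (Atom p ts) then show ?case by (auto simp: tvars_tsubst)
next
  case (Conj a b) then show ?case by (simp add: UN_Un)
next
  case (Disj a b) then show ?case by (simp add: UN_Un)
next
  case (BAll x t \<phi>)
  have IH: "fv (subst (\<sigma>(x := Var x)) \<phi>) = (\<Union>v\<in>fv \<phi>. tvars ((\<sigma>(x := Var x)) v))"
    using BAll.prems by (intro BAll.IH) (simp only: substble.simps)
  show ?case using BAll.prems by (auto simp: IH tvars_tsubst split: if_splits)
next
  case (Ex x \<phi>)
  have IH: "fv (subst (\<sigma>(x := Var x)) \<phi>) = (\<Union>v\<in>fv \<phi>. tvars ((\<sigma>(x := Var x)) v))"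
    using Ex.prems by (intro Ex.IH) (simp only: substble.simps)
  show ?case using Ex.prems by (auto simp: IH split: if_splits)
qed simp_all

lemma subst_subst: "substble \<tau> \<phi> \<Longrightarrow> subst \<sigma> (subst \<tau> \<phi>) = subst (\<lambda>v. tsubst \<sigma> (\<tau> v)) \<phi>"
proof (induction \<phi> arbitrary: \<sigma> \<tau>)
  case (Atom p ts) then show ?case by (simp add: tsubst_tsubst)
next
  case (BAll x t \<phi>)
  have h: "substble (\<tau>(x := Var x)) \<phi>" using BAll.prems by (simp only: substble.simps)
  have "subst (\<sigma>(x := Var x)) (subst (\<tau>(x := Var x)) \<phi>)
      = subst (\<lambda>v. tsubst (\<sigma>(x := Var x)) ((\<tau>(x := Var x)) v)) \<phi>" by (rule BAll.IH[OF h])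
  also have "\<dots> = subst ((\<lambda>v. tsubst \<sigma> (\<tau> v))(x := Var x)) \<phi>"
  proof (rule subst_cong)
    fix v assume "v \<in> fv \<phi>"
    then show "tsubst (\<sigma>(x := Var x)) ((\<tau>(x := Var x)) v) = ((\<lambda>v. tsubst \<sigma> (\<tau> v))(x := Var x)) v"
      using BAll.prems by (cases "v = x") (auto intro!: tsubst_cong)
  qed
  finally show ?case by (simp add: tsubst_tsubst)
next
  case (Ex x \<phi>)
  have h: "substble (\<tau>(x := Var x)) \<phi>" using Ex.prems by (simp only: substble.simps)
  have "subst (\<sigma>(x := Var x)) (subst (\<tau>(x := Var x)) \<phi>)
      = subst (\<lambda>v. tsubst (\<sigma>(x := Var x)) ((\<tau>(x := Var x)) v)) \<phi>" by (rule Ex.IH[OF h])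
  also have "\<dots> = subst ((\<lambda>v. tsubst \<sigma> (\<tau> v))(x := Var x)) \<phi>"
  proof (rule subst_cong)
    fix v assume "v \<in> fv \<phi>"
    then show "tsubst (\<sigma>(x := Var x)) ((\<tau>(x := Var x)) v) = ((\<lambda>v. tsubst \<sigma> (\<tau> v))(x := Var x)) v"
      using Ex.prems by (cases "v = x") (auto intro!: tsubst_cong)
  qed
  finally show ?case by simp
qed simp_all

lemma capture_condition_subst:
  assumes fvs: "fv \<psi> = (\<Union>v\<in>fv \<phi>. tvars ((\<tau>(x := Var x)) v))"
    and h2: "\<forall>v \<in> fv \<phi> - {x}. x \<notin> tvars (\<tau> v)"
  shows "(\<forall>v \<in> fv \<psi> - {x}. x \<notin> tvars (\<sigma> v))
         = (\<forall>v \<in> fv \<phi> - {x}. x \<notin> tvars (tsubst \<sigma> (\<tau> v)))"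
proof
  assume L: "\<forall>v \<in> fv \<psi> - {x}. x \<notin> tvars (\<sigma> v)"
  show "\<forall>v \<in> fv \<phi> - {x}. x \<notin> tvars (tsubst \<sigma> (\<tau> v))"
  proof (intro ballI notI)
    fix v assume v: "v \<in> fv \<phi> - {x}" and "x \<in> tvars (tsubst \<sigma> (\<tau> v))"
    then obtain w where w: "w \<in> tvars (\<tau> v)" "x \<in> tvars (\<sigma> w)" by (auto simp: tvars_tsubst)
    have "w \<noteq> x" using h2 v w by auto
    have "w \<in> tvars ((\<tau>(x:=Var x)) v)" using v w by simp
    then have "w \<in> fv \<psi> - {x}" unfolding fvs using v \<open>w\<noteq>x\<close> by blast
    then show False using L w by blast
  qed
next
  assume R: "\<forall>v \<in> fv \<phi> - {x}. x \<notin> tvars (tsubst \<sigma> (\<tau> v))"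
  show "\<forall>v \<in> fv \<psi> - {x}. x \<notin> tvars (\<sigma> v)"
  proof
    fix w assume "w \<in> fv \<psi> - {x}"
    then obtain u where u: "u \<in> fv \<phi>" "w \<in> tvars ((\<tau>(x:=Var x)) u)" "w \<noteq> x" unfolding fvs by auto
    then have "u \<noteq> x" by (cases "u = x") auto
    then have "w \<in> tvars (\<tau> u)" using u by simp
    then show "x \<notin> tvars (\<sigma> w)" using R u \<open>u\<noteq>x\<close> by (auto simp: tvars_tsubst)
  qed
qed

lemma substble_subst: "substble \<tau> \<phi> \<Longrightarrow> substble \<sigma> (subst \<tau> \<phi>) = substble (\<lambda>v. tsubst \<sigma> (\<tau> v)) \<phi>"
proof (induction \<phi> arbitrary: \<sigma> \<tau>)
  case (BAll x t \<phi>)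
  have h: "substble (\<tau>(x := Var x)) \<phi>" and h2: "\<forall>v \<in> fv \<phi> - {x}. x \<notin> tvars (\<tau> v)"
    using BAll.prems by auto
  have "substble (\<sigma>(x := Var x)) (subst (\<tau>(x := Var x)) \<phi>)
      = substble (\<lambda>v. tsubst (\<sigma>(x := Var x)) ((\<tau>(x := Var x)) v)) \<phi>" by (rule BAll.IH[OF h])
  also have "\<dots> = substble ((\<lambda>v. tsubst \<sigma> (\<tau> v))(x := Var x)) \<phi>"
  proof (rule substble_cong)
    fix v assume "v \<in> fv \<phi>"
    then show "tsubst (\<sigma>(x := Var x)) ((\<tau>(x := Var x)) v) = ((\<lambda>v. tsubst \<sigma> (\<tau> v))(x := Var x)) v"
      using h2 by (cases "v = x") (auto intro!: tsubst_cong)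
  qed
  finally have A: "substble (\<sigma>(x := Var x)) (subst (\<tau>(x := Var x)) \<phi>) = substble ((\<lambda>v. tsubst \<sigma> (\<tau> v))(x := Var x)) \<phi>" .
  have fvs: "fv (subst (\<tau>(x := Var x)) \<phi>) = (\<Union>v\<in>fv \<phi>. tvars ((\<tau>(x := Var x)) v))"
    by (rule fv_subst[OF h])
  have B: "(\<forall>v \<in> fv (subst (\<tau>(x := Var x)) \<phi>) - {x}. x \<notin> tvars (\<sigma> v))
         = (\<forall>v \<in> fv \<phi> - {x}. x \<notin> tvars (tsubst \<sigma> (\<tau> v)))"
    by (rule capture_condition_subst[OF fvs h2])
  show ?case using A B by simp
next
  case (Ex x \<phi>)
  have h: "substble (\<tau>(x := Var x)) \<phi>" and h2: "\<forall>v \<in> fv \<phi> - {x}. x \<notin> tvars (\<tau> v)"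
    using Ex.prems by auto
  have "substble (\<sigma>(x := Var x)) (subst (\<tau>(x := Var x)) \<phi>)
      = substble (\<lambda>v. tsubst (\<sigma>(x := Var x)) ((\<tau>(x := Var x)) v)) \<phi>" by (rule Ex.IH[OF h])
  also have "\<dots> = substble ((\<lambda>v. tsubst \<sigma> (\<tau> v))(x := Var x)) \<phi>"
  proof (rule substble_cong)
    fix v assume "v \<in> fv \<phi>"
    then show "tsubst (\<sigma>(x := Var x)) ((\<tau>(x := Var x)) v) = ((\<lambda>v. tsubst \<sigma> (\<tau> v))(x := Var x)) v"
      using h2 by (cases "v = x") (auto intro!: tsubst_cong)
  qed
  finally have A: "substble (\<sigma>(x := Var x)) (subst (\<tau>(x := Var x)) \<phi>) = substble ((\<lambda>v. tsubst \<sigma> (\<tau> v))(x := Var x)) \<phi>" .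
  have fvs: "fv (subst (\<tau>(x := Var x)) \<phi>) = (\<Union>v\<in>fv \<phi>. tvars ((\<tau>(x := Var x)) v))"
    by (rule fv_subst[OF h])
  have B: "(\<forall>v \<in> fv (subst (\<tau>(x := Var x)) \<phi>) - {x}. x \<notin> tvars (\<sigma> v))
         = (\<forall>v \<in> fv \<phi> - {x}. x \<notin> tvars (tsubst \<sigma> (\<tau> v)))"
    by (rule capture_condition_subst[OF fvs h2])
  show ?case using A B by simp
qed simp_all

lemma substble_if_bv_disjoint: "\<forall>v\<in>fv \<phi>. tvars (\<sigma> v) \<inter> bv \<phi> \<subseteq> {v} \<Longrightarrow> substble \<sigma> \<phi>"
proof (induction \<phi> arbitrary: \<sigma>)
  case (BAll x t \<phi>)
  then have pre: "\<forall>v\<in>fv \<phi> - {x}. tvars (\<sigma> v) \<inter> insert x (bv \<phi>) \<subseteq> {v}" by auto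
  have "substble (\<sigma>(x := Var x)) \<phi>" by (rule BAll.IH) (use pre in auto)
  moreover have "\<forall>v\<in>fv \<phi> - {x}. x \<notin> tvars (\<sigma> v)" using pre by auto
  ultimately show ?case by simp
next
  case (Ex x \<phi>)
  then have pre: "\<forall>v\<in>fv \<phi> - {x}. tvars (\<sigma> v) \<inter> insert x (bv \<phi>) \<subseteq> {v}" by auto
  have "substble (\<sigma>(x := Var x)) \<phi>" by (rule Ex.IH) (use pre in auto)
  moreover have "\<forall>v\<in>fv \<phi> - {x}. x \<notin> tvars (\<sigma> v)" using pre by auto
  ultimately show ?case by simp
next
  case (Conj \<phi> \<psi>)
  have "substble \<sigma> \<phi>" "substble \<sigma> \<psi>" by (rule Conj.IH; use Conj.prems in auto)+
  then show ?case by simp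
next
  case (Disj \<phi> \<psi>)
  have "substble \<sigma> \<phi>" "substble \<sigma> \<psi>" by (rule Disj.IH; use Disj.prems in auto)+
  then show ?case by simp
qed simp_all

lemma substble_rename: "c \<notin> bv \<psi> \<Longrightarrow> substble (Var(x := Var c)) \<psi>"
  by (rule substble_if_bv_disjoint) auto

lemma rename_back:
  assumes "c \<notin> fv \<psi>" "c \<notin> bv \<psi>"
  shows subst_rename_back: "subst (Var(c := Var x)) (subst (Var(x := Var c)) \<psi>) = \<psi>"
    and substble_rename_back: "substble (Var(c := Var x)) (subst (Var(x := Var c)) \<psi>)"
proof -
  have s: "substble (Var(x := Var c)) \<psi>" by (rule substble_rename[OF assms(2)])
  have "subst (Var(c := Var x)) (subst (Var(x := Var c)) \<psi>)
     = subst (\<lambda>v. tsubst (Var(c := Var x)) ((Var(x := Var c)) v)) \<psi>" by (rule subst_subst[OF s])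
  also have "\<dots> = subst Var \<psi>" by (rule subst_cong) (use assms in auto)
  finally show "subst (Var(c := Var x)) (subst (Var(x := Var c)) \<psi>) = \<psi>" by simp
  have "substble (Var(c := Var x)) (subst (Var(x := Var c)) \<psi>)
     = substble (\<lambda>v. tsubst (Var(c := Var x)) ((Var(x := Var c)) v)) \<psi>" by (rule substble_subst[OF s])
  also have "\<dots> = substble Var \<psi>" by (rule substble_cong) (use assms in auto)
  finally show "substble (Var(c := Var x)) (subst (Var(x := Var c)) \<psi>)" by simp
qed

lemma fv_rename_subset: "fv (subst (Var(x := Var c)) \<psi>) \<subseteq> (fv \<psi> - {x}) \<union> {c}"
  using fv_subst_subset[of "Var(x := Var c)" \<psi>] by (auto split: if_splits)

primrec ctx_wf :: "('f \<Rightarrow> nat) \<Rightarrow> ('p \<Rightarrow> nat) \<Rightarrow> ('f, 'p) ctx \<Rightarrow> bool" where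
  "ctx_wf FA PA Hole = True"
| "ctx_wf FA PA (CConjL C \<psi>) = (ctx_wf FA PA C \<and> fwf FA PA \<psi>)"
| "ctx_wf FA PA (CConjR \<phi> C) = (fwf FA PA \<phi> \<and> ctx_wf FA PA C)"
| "ctx_wf FA PA (CDisjL C \<psi>) = (ctx_wf FA PA C \<and> fwf FA PA \<psi>)"
| "ctx_wf FA PA (CDisjR \<phi> C) = (fwf FA PA \<phi> \<and> ctx_wf FA PA C)"
| "ctx_wf FA PA (CBAll x t C) = (twf FA t \<and> ctx_wf FA PA C)"
| "ctx_wf FA PA (CEx x C) = ctx_wf FA PA C"

lemma fwf_plug [simp]: "fwf FA PA (plug C \<phi>) \<longleftrightarrow> ctx_wf FA PA C \<and> fwf FA PA \<phi>"
  by (induction C) auto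

primrec ctx_comp :: "('f, 'p) ctx \<Rightarrow> ('f, 'p) ctx \<Rightarrow> ('f, 'p) ctx" where
  "ctx_comp Hole D = D"
| "ctx_comp (CConjL C \<psi>) D = CConjL (ctx_comp C D) \<psi>"
| "ctx_comp (CConjR \<phi> C) D = CConjR \<phi> (ctx_comp C D)"
| "ctx_comp (CDisjL C \<psi>) D = CDisjL (ctx_comp C D) \<psi>"
| "ctx_comp (CDisjR \<phi> C) D = CDisjR \<phi> (ctx_comp C D)"
| "ctx_comp (CBAll x t C) D = CBAll x t (ctx_comp C D)"
| "ctx_comp (CEx x C) D = CEx x (ctx_comp C D)"

lemma plug_ctx_comp: "plug (ctx_comp C D) \<phi> = plug C (plug D \<phi>)"
  by (induction C) auto

lemma application_plug: "application c \<phi> \<psi> \<Longrightarrow> application c (plug C \<phi>) (plug C \<psi>)"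
  unfolding application_def by (metis plug_ctx_comp)

locale positivistic_calculus =
  fixes FA :: "'f \<Rightarrow> nat" and PA :: "'p \<Rightarrow> nat" and T :: "('f, 'p) cond set"
begin

abbreviation wff :: "('f, 'p) fm \<Rightarrow> bool" where
  "wff \<equiv> fwf FA PA"

inductive derives :: "('f, 'p) fm \<Rightarrow> ('f, 'p) fm \<Rightarrow> bool" where
  derives_refl: "wff \<phi> \<Longrightarrow> derives \<phi> \<phi>"
| derives_step: "derives \<phi> \<psi> \<Longrightarrow> c \<in> T \<union> logax FA PA \<Longrightarrow> application c \<psi> \<chi> \<Longrightarrow> wff \<chi>
    \<Longrightarrow> derives \<phi> \<chi>"

lemma derives_wffD:
  assumes "derives \<phi> \<psi>" shows derives_wffD1: "wff \<phi>" and derives_wffD2: "wff \<psi>"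
  using assms by (induction rule: derives.induct) auto

lemma derives_trans [trans]:
  assumes "derives \<phi> \<psi>" "derives \<psi> \<chi>" shows "derives \<phi> \<chi>"
  using assms(2,1) by (induction rule: derives.induct) (auto intro: derives_step)

lemma derives_plug: "derives \<phi> \<psi> \<Longrightarrow> ctx_wf FA PA C \<Longrightarrow> derives (plug C \<phi>) (plug C \<psi>)"
  by (induction rule: derives.induct) (auto intro: derives.intros application_plug)

lemma fp_proof_snoc:
  assumes "fp_proof FA PA T xs \<phi> \<psi>" "c \<in> T \<union> logax FA PA" "application c \<psi> \<chi>" "wff \<chi>"
  shows "fp_proof FA PA T (xs @ [\<chi>]) \<phi> \<chi>"
  unfolding fp_proof_def
proof (intro conjI allI impI)
  show "xs @ [\<chi>] \<noteq> []" "last (xs @ [\<chi>]) = \<chi>" by simp_all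
  show "hd (xs @ [\<chi>]) = \<phi>" "list_all wff (xs @ [\<chi>])" using assms unfolding fp_proof_def by simp_all
  fix i assume i: "Suc i < length (xs @ [\<chi>])"
  show "\<exists>c\<in>T \<union> logax FA PA. application c ((xs @ [\<chi>]) ! i) ((xs @ [\<chi>]) ! Suc i)"
  proof (cases "Suc i < length xs")
    case True then show ?thesis using assms(1) unfolding fp_proof_def by (simp add: nth_append)
  next
    case False
    then have "Suc i = length xs" using i by simp
    moreover have "xs ! i = \<psi>" using assms(1) \<open>Suc i = length xs\<close> unfolding fp_proof_def
      by (metis diff_Suc_1 last_conv_nth)
    ultimately show ?thesis using assms(2,3) by (auto simp: nth_append)
  qed
qed

lemma derives_fp_provable: "derives \<phi> \<psi> \<Longrightarrow> fp_provable FA PA T \<phi> \<psi>"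
proof (induction rule: derives.induct)
  case (derives_refl \<phi>)
  then show ?case unfolding fp_provable_def fp_proof_def by (intro exI[of _ "[\<phi>]"]) auto
next
  case (derives_step \<phi> \<psi> c \<chi>)
  then show ?case unfolding fp_provable_def using fp_proof_snoc by blast
qed

lemma derives_instance:
  assumes "(\<phi>, \<psi>) \<in> T \<union> logax FA PA" "wff \<phi>" "wff \<psi>" "\<And>v. twf FA (\<sigma> v)"
    "substble \<sigma> \<phi>" "substble \<sigma> \<psi>"
  shows "derives (subst \<sigma> \<phi>) (subst \<sigma> \<psi>)"
proof -
  have "application (\<phi>, \<psi>) (subst \<sigma> \<phi>) (subst \<sigma> \<psi>)"
    unfolding application_def using assms(5,6) by (intro exI[of _ Hole] exI[of _ \<sigma>]) simp
  moreover have "wff (subst \<sigma> \<phi>)" "wff (subst \<sigma> \<psi>)" using assms(2-4) by (simp_all add: fwf_subst)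
  ultimately show ?thesis using assms(1) by (meson derives_refl derives_step)
qed

lemma derives_logax: "(\<phi>, \<psi>) \<in> logax FA PA \<Longrightarrow> wff \<phi> \<Longrightarrow> wff \<psi> \<Longrightarrow> derives \<phi> \<psi>"
  using derives_instance[of \<phi> \<psi> Var] by simp

lemma derives_Top: "wff \<phi> \<Longrightarrow> derives \<phi> Top"
  by (simp add: derives_logax logax.P1)

lemma Bot_derives: "wff \<phi> \<Longrightarrow> derives Bot \<phi>"
  by (simp add: derives_logax logax.P2)

lemma Conj_derives1: "wff \<phi> \<Longrightarrow> wff \<psi> \<Longrightarrow> derives (Conj \<phi> \<psi>) \<phi>"
  by (simp add: derives_logax logax.P3)

lemma Conj_derives2: "wff \<phi> \<Longrightarrow> wff \<psi> \<Longrightarrow> derives (Conj \<phi> \<psi>) \<psi>"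
  by (simp add: derives_logax logax.P4)

lemma derives_Conj_self: "wff \<phi> \<Longrightarrow> derives \<phi> (Conj \<phi> \<phi>)"
  by (simp add: derives_logax logax.P5)

lemma derives_Disj1: "wff \<phi> \<Longrightarrow> wff \<psi> \<Longrightarrow> derives \<phi> (Disj \<phi> \<psi>)"
  by (simp add: derives_logax logax.P6)

lemma derives_Disj2: "wff \<phi> \<Longrightarrow> wff \<psi> \<Longrightarrow> derives \<psi> (Disj \<phi> \<psi>)"
  by (simp add: derives_logax logax.P7)

lemma Disj_self_derives: "wff \<phi> \<Longrightarrow> derives (Disj \<phi> \<phi>) \<phi>"
  by (simp add: derives_logax logax.P8)

lemma Conj_Disj_distrib_derives:
  "wff \<phi> \<Longrightarrow> wff \<psi> \<Longrightarrow> wff \<chi> \<Longrightarrow> derives (Conj (Disj \<phi> \<psi>) \<chi>) (Disj (Conj \<phi> \<chi>) (Conj \<psi> \<chi>))"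
  by (simp add: derives_logax logax.P9)

lemma derives_Conj_mono:
  assumes "derives \<phi> \<phi>'" "derives \<psi> \<psi>'" shows "derives (Conj \<phi> \<psi>) (Conj \<phi>' \<psi>')"
proof -
  have "derives (Conj \<phi> \<psi>) (Conj \<phi>' \<psi>)"
    using derives_plug[OF assms(1), of "CConjL Hole \<psi>"] derives_wffD1[OF assms(2)] by simp
  also have "derives \<dots> (Conj \<phi>' \<psi>')"
    using derives_plug[OF assms(2), of "CConjR \<phi>' Hole"] derives_wffD2[OF assms(1)] by simp
  finally show ?thesis .
qed

lemma derives_Disj_mono:
  assumes "derives \<phi> \<phi>'" "derives \<psi> \<psi>'" shows "derives (Disj \<phi> \<psi>) (Disj \<phi>' \<psi>')"
proof -
  have "derives (Disj \<phi> \<psi>) (Disj \<phi>' \<psi>)"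
    using derives_plug[OF assms(1), of "CDisjL Hole \<psi>"] derives_wffD1[OF assms(2)] by simp
  also have "derives \<dots> (Disj \<phi>' \<psi>')"
    using derives_plug[OF assms(2), of "CDisjR \<phi>' Hole"] derives_wffD2[OF assms(1)] by simp
  finally show ?thesis .
qed

lemma derives_Ex_mono: "derives \<phi> \<psi> \<Longrightarrow> derives (Ex x \<phi>) (Ex x \<psi>)"
  using derives_plug[of \<phi> \<psi> "CEx x Hole"] by simp

lemma derives_BAll_mono: "derives \<phi> \<psi> \<Longrightarrow> twf FA t \<Longrightarrow> derives (BAll x t \<phi>) (BAll x t \<psi>)"
  using derives_plug[of \<phi> \<psi> "CBAll x t Hole"] by simp

lemma derives_ConjI:
  assumes "derives \<phi> \<psi>" "derives \<phi> \<chi>" shows "derives \<phi> (Conj \<psi> \<chi>)"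
  using derives_Conj_self[OF derives_wffD1[OF assms(1)]] derives_Conj_mono[OF assms]
  by (rule derives_trans)

lemma Disj_derivesI:
  assumes "derives \<phi> \<chi>" "derives \<psi> \<chi>" shows "derives (Disj \<phi> \<psi>) \<chi>"
  using derives_Disj_mono[OF assms] Disj_self_derives[OF derives_wffD2[OF assms(1)]]
  by (rule derives_trans)

lemma Conj_commute_derives: "wff \<phi> \<Longrightarrow> wff \<psi> \<Longrightarrow> derives (Conj \<phi> \<psi>) (Conj \<psi> \<phi>)"
  by (intro derives_ConjI Conj_derives1 Conj_derives2)

lemma Disj_commute_derives: "wff \<phi> \<Longrightarrow> wff \<psi> \<Longrightarrow> derives (Disj \<phi> \<psi>) (Disj \<psi> \<phi>)"
  by (intro Disj_derivesI derives_Disj1 derives_Disj2)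

lemma derives_cut:
  assumes PQ: "derives \<chi> (Disj \<phi> \<psi>)" and P: "derives (Conj \<chi> \<phi>) \<theta>" and Q: "derives \<psi> \<theta>"
  shows "derives \<chi> \<theta>"
proof -
  have wff: "wff \<chi>" "wff \<phi>" "wff \<psi>"
    using derives_wffD1[OF P] derives_wffD1[OF Q] by simp_all
  have "derives \<chi> (Conj \<chi> \<chi>)" by (rule derives_Conj_self[OF wff(1)])
  also have "derives \<dots> (Conj (Disj \<phi> \<psi>) \<chi>)"
    by (rule derives_Conj_mono[OF PQ derives_refl[OF wff(1)]])
  also have "derives \<dots> (Disj (Conj \<phi> \<chi>) (Conj \<psi> \<chi>))"
    by (rule Conj_Disj_distrib_derives[OF wff(2,3,1)])
  also have "derives \<dots> \<theta>"
  proof (rule Disj_derivesI)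
    show "derives (Conj \<phi> \<chi>) \<theta>" using Conj_commute_derives[OF wff(2,1)] P by (rule derives_trans)
    show "derives (Conj \<psi> \<chi>) \<theta>" using Conj_derives1[OF wff(3,1)] Q by (rule derives_trans)
  qed
  finally show ?thesis .
qed

end

context positivistic_calculus
begin

lemma Ex_vacuous_derives: "wff \<phi> \<Longrightarrow> y \<notin> fv \<phi> \<Longrightarrow> derives (Ex y \<phi>) \<phi>"
  by (simp add: derives_logax logax.P11)

lemma Conj_Ex_derives:
  "wff \<chi> \<Longrightarrow> wff \<phi> \<Longrightarrow> y \<notin> fv \<chi> \<Longrightarrow> derives (Conj \<chi> (Ex y \<phi>)) (Ex y (Conj \<chi> \<phi>))"
  by (simp add: derives_logax logax.P12)

lemma Ex_rename_derives:
  assumes wff: "wff \<psi>" and c: "c \<notin> fv \<psi>" "c \<notin> bv \<psi>" "c \<noteq> x"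
  shows "derives (Ex x \<psi>) (Ex c (subst (Var(x := Var c)) \<psi>))"
proof -
  let ?\<psi>c = "subst (Var(x := Var c)) \<psi>"
  have wff_c: "wff ?\<psi>c" using wff by (intro fwf_subst) auto
  have "derives (subst (Var(c := Var x)) ?\<psi>c) (subst (Var(c := Var x)) (Ex c ?\<psi>c))"
    using wff_c substble_rename_back[OF c(1,2)] by (intro derives_instance) (auto intro: logax.P10)
  then have "derives \<psi> (Ex c ?\<psi>c)" using subst_rename_back[OF c(1,2)] by simp
  then have "derives (Ex x \<psi>) (Ex x (Ex c ?\<psi>c))" by (rule derives_Ex_mono)
  also have "derives \<dots> (Ex c ?\<psi>c)"
    using wff_c fv_rename_subset[of x c \<psi>] c by (intro Ex_vacuous_derives) auto
  finally show ?thesis .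
qed

text \<open>The equality axiom P23 only speaks about variables; a general instance is obtained by
  first renaming the substituted variable apart to two fresh variables.\<close>

lemma Eq_subst_derives:
  assumes wff: "wff \<phi>" and ab: "twf FA a" "twf FA b" and \<tau>: "\<And>v. twf FA (\<tau> v)"
    and sa: "substble (\<tau>(z := a)) \<phi>" and sb: "substble (\<tau>(z := b)) \<phi>"
  shows "derives (Conj (Atom PEq [a, b]) (subst (\<tau>(z := a)) \<phi>)) (subst (\<tau>(z := b)) \<phi>)"
proof -
  obtain x' where x': "x' \<notin> fv \<phi> \<union> bv \<phi> \<union> {z}"
    using ex_fresh_var[of "fv \<phi> \<union> bv \<phi> \<union> {z}"] by auto
  obtain y' where y': "y' \<notin> fv \<phi> \<union> bv \<phi> \<union> {z, x'}"
    using ex_fresh_var[of "fv \<phi> \<union> bv \<phi> \<union> {z, x'}"] by auto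
  let ?\<sigma> = "\<tau>(x' := a, y' := b)"
  have rename: "subst ?\<sigma> (subst (Var(z := Var u)) \<phi>) = subst (\<tau>(z := s)) \<phi> \<and>
      substble ?\<sigma> (subst (Var(z := Var u)) \<phi>)"
    if u: "u \<notin> bv \<phi>" "?\<sigma> u = s" and s: "substble (\<tau>(z := s)) \<phi>" for u s
  proof -
    have agree: "tsubst ?\<sigma> ((Var(z := Var u)) v) = (\<tau>(z := s)) v" if "v \<in> fv \<phi>" for v
      using that u x' y' by auto
    have "subst ?\<sigma> (subst (Var(z := Var u)) \<phi>)
        = subst (\<lambda>v. tsubst ?\<sigma> ((Var(z := Var u)) v)) \<phi>"
      by (rule subst_subst[OF substble_rename[OF u(1)]])
    also have "\<dots> = subst (\<tau>(z := s)) \<phi>" by (rule subst_cong[OF agree])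
    moreover have "substble ?\<sigma> (subst (Var(z := Var u)) \<phi>)
        = substble (\<lambda>v. tsubst ?\<sigma> ((Var(z := Var u)) v)) \<phi>"
      by (rule substble_subst[OF substble_rename[OF u(1)]])
    moreover have "\<dots> = substble (\<tau>(z := s)) \<phi>" by (rule substble_cong[OF agree])
    ultimately show ?thesis using s by simp
  qed
  have "derives (subst ?\<sigma> (Conj (vEq x' y') (subst (Var(z := Var x')) \<phi>)))
                (subst ?\<sigma> (subst (Var(z := Var y')) \<phi>))"
    using wff ab \<tau> x' y' rename[of x' a] rename[of y' b] sa sb
    by (intro derives_instance) (auto intro!: logax.P23 fwf_subst substble_rename)
  then show ?thesis using rename[of x' a] rename[of y' b] x' y' sa sb by auto
qed

lemma derives_Eq_refl: "twf FA a \<Longrightarrow> derives Top (Atom PEq [a, a])"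
  using derives_instance[of Top "vEq 0 0" "Var(0 := a)"] by (simp add: logax.P20)

lemma Eq_sym_derives: "twf FA a \<Longrightarrow> twf FA b \<Longrightarrow> derives (Atom PEq [a, b]) (Atom PEq [b, a])"
  using derives_instance[of "vEq 0 1" "vEq 1 0" "Var(0 := a, 1 := b)"] by (simp add: logax.P21)

lemma Eq_trans_derives: "twf FA a \<Longrightarrow> twf FA b \<Longrightarrow> twf FA c \<Longrightarrow>
    derives (Conj (Atom PEq [a, b]) (Atom PEq [b, c])) (Atom PEq [a, c])"
  using derives_instance[of "Conj (vEq 0 1) (vEq 1 2)" "vEq 0 2" "Var(0 := a, 1 := b, 2 := c)"]
  by (simp add: logax.P22)

lemma derives_Ex_Eq:
  assumes wff: "wff \<phi>" and t: "twf FA t" and w: "w \<notin> fv \<phi>" "w \<notin> tvars t"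
  shows "derives \<phi> (Ex w (Conj \<phi> (Atom PEq [Var w, t])))"
proof -
  let ?\<psi> = "Conj \<phi> (Atom PEq [Var w, t])"
  have "derives \<phi> (Conj \<phi> (Atom PEq [t, t]))"
    using derives_refl[OF wff] derives_trans[OF derives_Top[OF wff] derives_Eq_refl[OF t]]
    by (rule derives_ConjI)
  also have "derives \<dots> (Ex w ?\<psi>)"
    using derives_instance[of ?\<psi> "Ex w ?\<psi>" "Var(w := t)"] wff t w
    by (simp add: logax.P10 subst_upd_fresh substble_upd_fresh tsubst_upd_fresh)
  finally show ?thesis .
qed

lemma BAll_Eq_bound_derives:
  assumes wff: "wff \<psi>" and ab: "twf FA a" "twf FA b"
  shows "derives (Conj (Atom PEq [a, b]) (BAll y a \<psi>)) (BAll y b \<psi>)"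
proof -
  obtain z where z: "z \<notin> fv \<psi> \<union> {y}" using ex_fresh_var[of "fv \<psi> \<union> {y}"] by auto
  let ?\<phi> = "BAll y (Var z) \<psi>"
  have "subst (Var(z := s)) ?\<phi> = BAll y s \<psi>" "substble (Var(z := s)) ?\<phi>" for s
    using z by (auto simp: subst_upd_fresh substble_upd_fresh)
  with Eq_subst_derives[of ?\<phi> a b Var z] wff ab show ?thesis by simp
qed

lemma BAll_rename_var_derives:
  assumes wff: "wff \<psi>" and c: "c \<notin> fv \<psi>" "c \<notin> bv \<psi>" "c \<noteq> x" and w: "w \<noteq> c" "w \<noteq> x"
  shows "derives (BAll c (Var w) (subst (Var(x := Var c)) \<psi>)) (BAll x (Var w) \<psi>)"
proof -
  let ?\<psi>c = "subst (Var(x := Var c)) \<psi>"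
  let ?B = "BAll c (Var w) ?\<psi>c"
  have wff_c: "wff ?\<psi>c" using wff by (intro fwf_subst) auto
  have "x \<notin> fv ?B" using fv_rename_subset[of x c \<psi>] w c by auto
  then have "derives ?B (BAll x (Var w) (Conj ?B (vIn x w)))"
    using wff_c by (simp add: derives_logax logax.P14)
  also have "derives \<dots> (BAll x (Var w) \<psi>)"
  proof (rule derives_BAll_mono)
    have "derives (Conj ?B (vIn x w)) (Conj (vIn x w) ?B)"
      using wff_c by (intro Conj_commute_derives) auto
    also have "derives \<dots> \<psi>"
      using derives_instance[of "Conj (vIn c w) ?B" ?\<psi>c "Var(c := Var x)"] wff_c w
        rename_back[OF c(1,2)] by (simp add: logax.P13)
    finally show "derives (Conj ?B (vIn x w)) \<psi>" .
  qed simp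
  finally show ?thesis .
qed

text \<open>For a bound given by an arbitrary term t, first name t by a fresh variable w.\<close>

lemma BAll_rename_derives:
  assumes wff: "wff \<psi>" and t: "twf FA t"
    and c: "c \<notin> fv \<psi>" "c \<notin> bv \<psi>" "c \<notin> tvars t" "c \<noteq> x"
  shows "derives (BAll c t (subst (Var(x := Var c)) \<psi>)) (BAll x t \<psi>)"
proof -
  let ?\<psi>c = "subst (Var(x := Var c)) \<psi>"
  let ?B = "BAll c t ?\<psi>c"
  have wff_B: "wff ?B" using wff t by (auto intro: fwf_subst)
  obtain w where w: "w \<notin> {x, c} \<union> tvars t \<union> fv \<psi> \<union> bv \<psi>"
    using ex_fresh_var[of "{x, c} \<union> tvars t \<union> fv \<psi> \<union> bv \<psi>"] by auto
  let ?E = "Atom PEq [Var w, t]"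
  have wff_E: "wff ?E" using t by simp
  have "w \<notin> fv ?B" using fv_rename_subset[of x c \<psi>] w by auto
  then have "derives ?B (Ex w (Conj ?B ?E))" using wff_B t w by (intro derives_Ex_Eq) auto
  also have "derives \<dots> (Ex w (BAll x t \<psi>))"
  proof (rule derives_Ex_mono)
    have "derives (Conj ?B ?E) (Conj (Atom PEq [t, Var w]) ?B)"
      using Conj_commute_derives[OF wff_B wff_E] derives_Conj_mono[OF Eq_sym_derives derives_refl[OF wff_B]] t
      by (simp add: derives_trans)
    also have "derives \<dots> (BAll c (Var w) ?\<psi>c)"
      using wff t by (intro BAll_Eq_bound_derives) (auto intro: fwf_subst)
    also have "derives \<dots> (BAll x (Var w) \<psi>)"
      using wff c w by (intro BAll_rename_var_derives) auto
    finally have "derives (Conj ?B ?E) (Conj ?E (BAll x (Var w) \<psi>))"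
      using Conj_derives2[OF wff_B wff_E] by (intro derives_ConjI)
    also have "derives \<dots> (BAll x t \<psi>)"
      using wff t by (intro BAll_Eq_bound_derives) auto
    finally show "derives (Conj ?B ?E) (BAll x t \<psi>)" .
  qed
  also have "derives \<dots> (BAll x t \<psi>)"
    using wff t w by (intro Ex_vacuous_derives) auto
  finally show ?thesis .
qed

lemma derives_BAll_intro:
  assumes wff: "wff \<phi>" and t: "twf FA t" and c: "c \<notin> fv \<phi>" "c \<notin> tvars t"
  shows "derives \<phi> (BAll c t (Conj \<phi> (Atom PIn [Var c, t])))"
proof -
  obtain z where z: "z \<notin> fv \<phi> \<union> {c}" using ex_fresh_var[of "fv \<phi> \<union> {c}"] by auto
  show ?thesis
    using derives_instance[of \<phi> "BAll c (Var z) (Conj \<phi> (vIn c z))" "Var(z := t)"] wff t c z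
    by (auto simp: logax.P14 subst_upd_fresh substble_upd_fresh)
qed

lemma BAll_Disj_derives:
  assumes wff: "wff \<chi>" "wff \<phi>" and t: "twf FA t" and c: "c \<notin> fv \<chi>" "c \<notin> tvars t"
  shows "derives (BAll c t (Disj \<chi> \<phi>)) (Disj \<chi> (BAll c t \<phi>))"
proof -
  obtain z where z: "z \<notin> fv \<chi> \<union> fv \<phi> \<union> {c}" using ex_fresh_var[of "fv \<chi> \<union> fv \<phi> \<union> {c}"] by auto
  show ?thesis
    using derives_instance[of "BAll c (Var z) (Disj \<chi> \<phi>)" "Disj \<chi> (BAll c (Var z) \<phi>)" "Var(z := t)"]
      wff t c z
    by (auto simp: logax.P15 subst_upd_fresh substble_upd_fresh)
qed

lemma derives_Ex_intro:
  assumes "wff \<psi>" "substble (Var(x := Var b)) \<psi>"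
  shows "derives (subst (Var(x := Var b)) \<psi>) (Ex x \<psi>)"
  using derives_instance[of \<psi> "Ex x \<psi>" "Var(x := Var b)"] assms by (simp add: logax.P10)

lemma In_BAll_derives:
  assumes wff: "wff \<psi>" and t: "twf FA t" and s: "substble (Var(x := Var b)) \<psi>"
  shows "derives (Conj (Atom PIn [Var b, t]) (BAll x t \<psi>)) (subst (Var(x := Var b)) \<psi>)"
proof -
  obtain z where z: "z \<notin> fv \<psi> \<union> {x}" using ex_fresh_var[of "fv \<psi> \<union> {x}"] by auto
  let ?\<sigma> = "Var(x := Var b, z := t)"
  have agree: "subst ?\<sigma> \<psi> = subst (Var(x := Var b)) \<psi>" "substble ?\<sigma> \<psi> = substble (Var(x := Var b)) \<psi>"
    using z by (auto intro!: subst_cong substble_cong)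
  have "(?\<sigma>)(x := Var x) = Var(z := t)" using z by auto
  then have "derives (subst ?\<sigma> (Conj (vIn x z) (BAll x (Var z) \<psi>))) (subst ?\<sigma> \<psi>)"
    using wff t s z agree by (intro derives_instance) (auto intro: logax.P13 simp: substble_upd_fresh)
  then show ?thesis using \<open>(?\<sigma>)(x := Var x) = Var(z := t)\<close> agree z by (simp add: subst_upd_fresh)
qed

end

primrec conjs :: "('f, 'p) fm list \<Rightarrow> ('f, 'p) fm" where
  "conjs [] = Top"
| "conjs (\<phi> # \<phi>s) = Conj \<phi> (conjs \<phi>s)"

primrec disjs :: "('f, 'p) fm list \<Rightarrow> ('f, 'p) fm" where
  "disjs [] = Bot"
| "disjs (\<phi> # \<phi>s) = Disj \<phi> (disjs \<phi>s)"

lemma fv_conjs: "fv (conjs \<phi>s) = (\<Union>\<phi>\<in>set \<phi>s. fv \<phi>)"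
  by (induction \<phi>s) auto

lemma fv_disjs: "fv (disjs \<phi>s) = (\<Union>\<phi>\<in>set \<phi>s. fv \<phi>)"
  by (induction \<phi>s) auto

definition fresh_in :: "nat \<Rightarrow> ('f, 'p) fm set \<Rightarrow> bool" where
  "fresh_in c S \<longleftrightarrow> (\<forall>\<phi>\<in>S. c \<notin> fv \<phi> \<and> c \<notin> bv \<phi>)"

definition fresh :: "('f, 'p) fm set \<Rightarrow> nat" where
  "fresh S = (SOME c. fresh_in c S)"

lemma fresh_in_fresh: "finite S \<Longrightarrow> fresh_in (fresh S) S"
proof -
  assume "finite S"
  then obtain c where "c \<notin> (\<Union>\<phi>\<in>S. fv \<phi> \<union> bv \<phi>)" using ex_fresh_var by (meson finite_UN_I finite_Un finite_bv finite_fv)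
  then have "fresh_in c S" unfolding fresh_in_def by blast
  then show ?thesis unfolding fresh_def by (rule someI)
qed

context positivistic_calculus
begin

lemma wff_conjs: "\<forall>\<phi>\<in>set \<phi>s. wff \<phi> \<Longrightarrow> wff (conjs \<phi>s)"
  by (induction \<phi>s) auto

lemma wff_disjs: "\<forall>\<phi>\<in>set \<phi>s. wff \<phi> \<Longrightarrow> wff (disjs \<phi>s)"
  by (induction \<phi>s) auto

lemma derives_conjsI: "wff \<psi> \<Longrightarrow> \<forall>\<phi>\<in>set \<phi>s. derives \<psi> \<phi> \<Longrightarrow> derives \<psi> (conjs \<phi>s)"
  by (induction \<phi>s) (auto intro: derives_Top derives_ConjI)

lemma disjs_derivesI: "wff \<psi> \<Longrightarrow> \<forall>\<phi>\<in>set \<phi>s. derives \<phi> \<psi> \<Longrightarrow> derives (disjs \<phi>s) \<psi>"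
  by (induction \<phi>s) (auto intro: Bot_derives Disj_derivesI)

lemma conjs_derives_member: "\<forall>\<phi>\<in>set \<phi>s. wff \<phi> \<Longrightarrow> \<psi> \<in> set \<phi>s \<Longrightarrow> derives (conjs \<phi>s) \<psi>"
proof (induction \<phi>s)
  case (Cons \<phi> \<phi>s)
  then have "wff \<phi>" "wff (conjs \<phi>s)" using wff_conjs by auto
  with Cons show ?case by (auto intro: Conj_derives1 derives_trans[OF Conj_derives2])
qed simp

lemma member_derives_disjs: "\<forall>\<phi>\<in>set \<phi>s. wff \<phi> \<Longrightarrow> \<psi> \<in> set \<phi>s \<Longrightarrow> derives \<psi> (disjs \<phi>s)"
proof (induction \<phi>s)
  case (Cons \<phi> \<phi>s)
  then have "wff \<phi>" "wff (disjs \<phi>s)" using wff_disjs by auto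
  with Cons show ?case by (auto intro: derives_Disj1 derives_trans[OF _ derives_Disj2])
qed simp

lemma conjs_derives_conjs:
  "\<forall>\<phi>\<in>set \<phi>s. wff \<phi> \<Longrightarrow> set \<psi>s \<subseteq> set \<phi>s \<Longrightarrow> derives (conjs \<phi>s) (conjs \<psi>s)"
  by (auto intro: derives_conjsI wff_conjs conjs_derives_member)

lemma disjs_derives_disjs:
  "\<forall>\<psi>\<in>set \<psi>s. wff \<psi> \<Longrightarrow> set \<phi>s \<subseteq> set \<psi>s \<Longrightarrow> derives (disjs \<phi>s) (disjs \<psi>s)"
  by (auto intro: disjs_derivesI wff_disjs member_derives_disjs)

definition inconsistent :: "('f, 'p) fm set \<Rightarrow> ('f, 'p) fm set \<Rightarrow> bool" where
  "inconsistent F G \<longleftrightarrow>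
     (\<exists>\<phi>s \<psi>s. set \<phi>s \<subseteq> F \<and> set \<psi>s \<subseteq> G \<and> derives (conjs \<phi>s) (disjs \<psi>s))"

lemma inconsistent_mono: "inconsistent F G \<Longrightarrow> F \<subseteq> F' \<Longrightarrow> G \<subseteq> G' \<Longrightarrow> inconsistent F' G'"
  unfolding inconsistent_def by blast

lemma inconsistentI:
  "set \<phi>s \<subseteq> F \<Longrightarrow> set \<psi>s \<subseteq> G \<Longrightarrow> derives (conjs \<phi>s) (disjs \<psi>s) \<Longrightarrow> inconsistent F G"
  unfolding inconsistent_def by blast

lemma inconsistent_if_derives:
  assumes "\<phi> \<in> F" "\<psi> \<in> G" "derives \<phi> \<psi>" shows "inconsistent F G"
proof (rule inconsistentI[of "[\<phi>]" _ "[\<psi>]"])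
  have "wff \<phi>" "wff \<psi>" using derives_wffD[OF assms(3)] by simp_all
  then have "derives (conjs [\<phi>]) \<phi>" "derives \<psi> (disjs [\<psi>])"
    by (simp_all add: Conj_derives1 derives_Disj1)
  with assms(3) show "derives (conjs [\<phi>]) (disjs [\<psi>])" by (blast intro: derives_trans)
qed (use assms in simp_all)

lemma consistent_cut:
  assumes wff: "\<forall>\<psi>\<in>F \<union> G. wff \<psi>" "wff \<phi>" and cons: "\<not> inconsistent F G"
    and "inconsistent (insert \<phi> F) G"
  shows "\<not> inconsistent F (insert \<phi> G)"
proof
  assume "inconsistent F (insert \<phi> G)"
  then obtain \<phi>s2 \<psi>s2 where 2: "set \<phi>s2 \<subseteq> F" "set \<psi>s2 \<subseteq> insert \<phi> G" "derives (conjs \<phi>s2) (disjs \<psi>s2)"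
    unfolding inconsistent_def by blast
  obtain \<phi>s1 \<psi>s1 where 1: "set \<phi>s1 \<subseteq> insert \<phi> F" "set \<psi>s1 \<subseteq> G" "derives (conjs \<phi>s1) (disjs \<psi>s1)"
    using \<open>inconsistent (insert \<phi> F) G\<close> unfolding inconsistent_def by blast
  define \<phi>s where "\<phi>s = removeAll \<phi> \<phi>s1 @ \<phi>s2"
  define \<psi>s where "\<psi>s = \<psi>s1 @ removeAll \<phi> \<psi>s2"
  define \<theta> where "\<theta> = disjs (removeAll \<phi> \<psi>s2)"
  have sub: "set \<phi>s \<subseteq> F" "set \<psi>s \<subseteq> G" using 1 2 unfolding \<phi>s_def \<psi>s_def by auto
  then have wff_lists: "\<forall>\<psi>\<in>set (\<phi> # \<phi>s). wff \<psi>" "\<forall>\<psi>\<in>set (\<phi> # \<psi>s). wff \<psi>"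
    using wff by auto
  have "derives (conjs \<phi>s) (conjs \<phi>s2)"
    using wff_lists(1) by (intro conjs_derives_conjs) (auto simp: \<phi>s_def)
  also have "derives \<dots> (disjs \<psi>s2)" by (fact 2(3))
  also have "derives \<dots> (Disj \<phi> \<theta>)"
    using disjs_derives_disjs[of "\<phi> # removeAll \<phi> \<psi>s2" \<psi>s2] 2(2) wff
    unfolding \<theta>_def by auto
  finally have cut: "derives (conjs \<phi>s) (Disj \<phi> \<theta>)" .
  have "derives (Conj (conjs \<phi>s) \<phi>) (conjs (\<phi> # \<phi>s))"
    using wff_lists(1) wff_conjs by (auto intro: Conj_commute_derives)
  also have "derives \<dots> (conjs \<phi>s1)"
    using wff_lists(1) 1(1) by (intro conjs_derives_conjs) (auto simp: \<phi>s_def)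
  also have "derives \<dots> (disjs \<psi>s1)" by (fact 1(3))
  also have "derives \<dots> (disjs \<psi>s)"
    using wff_lists(2) by (intro disjs_derives_disjs) (auto simp: \<psi>s_def)
  finally have "derives (Conj (conjs \<phi>s) \<phi>) (disjs \<psi>s)" .
  moreover have "derives \<theta> (disjs \<psi>s)"
    using wff_lists(2) unfolding \<theta>_def by (intro disjs_derives_disjs) (auto simp: \<psi>s_def)
  ultimately have "derives (conjs \<phi>s) (disjs \<psi>s)" by (rule derives_cut[OF cut])
  with cons sub show False unfolding inconsistent_def by blast
qed

end

context positivistic_calculus
begin

lemma consistent_Ex_witness:
  assumes wff: "\<forall>\<phi>\<in>F \<union> G. wff \<phi>" and cons: "\<not> inconsistent F G" and ex: "Ex x \<psi> \<in> F"
    and fresh: "fresh_in c (F \<union> G)"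
  shows "\<not> inconsistent (insert (subst (Var(x := Var c)) \<psi>) F) G"
proof
  let ?\<psi>c = "subst (Var(x := Var c)) \<psi>"
  assume "inconsistent (insert ?\<psi>c F) G"
  then obtain \<phi>s \<psi>s where 1: "set \<phi>s \<subseteq> insert ?\<psi>c F" "set \<psi>s \<subseteq> G" "derives (conjs \<phi>s) (disjs \<psi>s)"
    unfolding inconsistent_def by blast
  define \<phi>s' where "\<phi>s' = removeAll ?\<psi>c \<phi>s"
  let ?\<Phi> = "conjs \<phi>s'" and ?\<Psi> = "disjs \<psi>s"
  have "wff (Ex x \<psi>)" using wff ex by blast
  then have wff_\<psi>: "wff \<psi>" by simp
  then have wff_\<psi>c: "wff ?\<psi>c" by (intro fwf_subst) auto
  have wff_lists: "\<forall>\<phi>\<in>set \<phi>s'. wff \<phi>" "\<forall>\<phi>\<in>set \<psi>s. wff \<phi>" using 1 wff unfolding \<phi>s'_def by auto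
  have wff_\<Phi>: "wff ?\<Phi>" and wff_\<Psi>: "wff ?\<Psi>" using wff_lists by (simp_all add: wff_conjs wff_disjs)
  have "c \<notin> fv (Ex x \<psi>)" "c \<notin> bv (Ex x \<psi>)" using fresh ex unfolding fresh_in_def by blast+
  moreover have "c \<notin> fv ?\<Phi>" "c \<notin> fv ?\<Psi>"
    using fresh 1 unfolding fresh_in_def fv_conjs fv_disjs \<phi>s'_def by auto
  ultimately have c: "c \<notin> fv \<psi>" "c \<notin> bv \<psi>" "c \<noteq> x" "c \<notin> fv ?\<Phi>" "c \<notin> fv ?\<Psi>" by auto
  have "derives (Conj ?\<psi>c ?\<Phi>) ?\<Psi>"
    using conjs_derives_conjs[of "?\<psi>c # \<phi>s'" \<phi>s] wff_\<psi>c wff_lists 1(3)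
    unfolding \<phi>s'_def by (auto intro: derives_trans)
  then have body: "derives (Conj ?\<Phi> ?\<psi>c) ?\<Psi>"
    using Conj_commute_derives[OF wff_\<Phi> wff_\<psi>c] by (rule derives_trans[rotated])
  have "derives (conjs (Ex x \<psi> # \<phi>s')) (Conj (Ex c ?\<psi>c) ?\<Phi>)"
    using derives_Conj_mono[OF Ex_rename_derives[OF wff_\<psi> c(1-3)] derives_refl[OF wff_\<Phi>]] by simp
  also have "derives \<dots> (Conj ?\<Phi> (Ex c ?\<psi>c))" using wff_\<Phi> wff_\<psi>c by (intro Conj_commute_derives) auto
  also have "derives \<dots> (Ex c (Conj ?\<Phi> ?\<psi>c))" by (rule Conj_Ex_derives[OF wff_\<Phi> wff_\<psi>c c(4)])
  also have "derives \<dots> (Ex c ?\<Psi>)" by (rule derives_Ex_mono[OF body])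
  also have "derives \<dots> ?\<Psi>" by (rule Ex_vacuous_derives[OF wff_\<Psi> c(5)])
  finally have "derives (conjs (Ex x \<psi> # \<phi>s')) ?\<Psi>" .
  moreover have "set (Ex x \<psi> # \<phi>s') \<subseteq> F" using 1 ex unfolding \<phi>s'_def by auto
  ultimately show False using cons 1(2) unfolding inconsistent_def by blast
qed

lemma consistent_BAll_counterexample:
  assumes wff: "\<forall>\<phi>\<in>F \<union> G. wff \<phi>" and cons: "\<not> inconsistent F G" and ball: "BAll x t \<psi> \<in> G"
    and fresh: "fresh_in c (F \<union> G)"
  shows "\<not> inconsistent (insert (Atom PIn [Var c, t]) F) (insert (subst (Var(x := Var c)) \<psi>) G)"
proof
  let ?\<psi>c = "subst (Var(x := Var c)) \<psi>" and ?A = "Atom PIn [Var c, t]"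
  assume "inconsistent (insert ?A F) (insert ?\<psi>c G)"
  then obtain \<phi>s \<psi>s where 1: "set \<phi>s \<subseteq> insert ?A F" "set \<psi>s \<subseteq> insert ?\<psi>c G"
      "derives (conjs \<phi>s) (disjs \<psi>s)"
    unfolding inconsistent_def by blast
  define \<phi>s' where "\<phi>s' = removeAll ?A \<phi>s"
  define \<psi>s' where "\<psi>s' = removeAll ?\<psi>c \<psi>s"
  let ?\<Phi> = "conjs \<phi>s'" and ?\<Psi> = "disjs \<psi>s'"
  have "wff (BAll x t \<psi>)" using wff ball by blast
  then have wff_\<psi>: "wff \<psi>" and t: "twf FA t" by simp_all
  then have wff_\<psi>c: "wff ?\<psi>c" and wff_A: "wff ?A" by (auto intro: fwf_subst)
  have wff_lists: "\<forall>\<phi>\<in>set \<phi>s'. wff \<phi>" "\<forall>\<phi>\<in>set \<psi>s'. wff \<phi>"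
    using 1 wff unfolding \<phi>s'_def \<psi>s'_def by auto
  have wff_\<Phi>: "wff ?\<Phi>" and wff_\<Psi>: "wff ?\<Psi>" using wff_lists by (simp_all add: wff_conjs wff_disjs)
  have "c \<notin> fv (BAll x t \<psi>)" "c \<notin> bv (BAll x t \<psi>)"
    using fresh ball unfolding fresh_in_def by blast+
  moreover have "c \<notin> fv ?\<Phi>" "c \<notin> fv ?\<Psi>"
    using fresh 1 unfolding fresh_in_def fv_conjs fv_disjs \<phi>s'_def \<psi>s'_def by auto
  ultimately have c: "c \<notin> fv \<psi>" "c \<notin> bv \<psi>" "c \<notin> tvars t" "c \<noteq> x" "c \<notin> fv ?\<Phi>" "c \<notin> fv ?\<Psi>"
    by auto
  have "derives (Conj ?\<Phi> ?A) (conjs (?A # \<phi>s'))" using wff_\<Phi> wff_A by (simp add: Conj_commute_derives)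
  also have "derives \<dots> (conjs \<phi>s)"
    using wff_A wff_lists(1) 1(1) unfolding \<phi>s'_def by (intro conjs_derives_conjs) auto
  also have "derives \<dots> (disjs \<psi>s)" by (fact 1(3))
  also have "derives \<dots> (disjs (?\<psi>c # \<psi>s'))"
    using wff_\<psi>c wff_lists(2) 1(2) unfolding \<psi>s'_def by (intro disjs_derives_disjs) auto
  also have "derives \<dots> (Disj ?\<Psi> ?\<psi>c)" using wff_\<Psi> wff_\<psi>c by (simp add: Disj_commute_derives)
  finally have body: "derives (Conj ?\<Phi> ?A) (Disj ?\<Psi> ?\<psi>c)" .
  have "derives ?\<Phi> (BAll c t (Conj ?\<Phi> ?A))" by (rule derives_BAll_intro[OF wff_\<Phi> t c(5,3)])
  also have "derives \<dots> (BAll c t (Disj ?\<Psi> ?\<psi>c))" by (rule derives_BAll_mono[OF body t])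
  also have "derives \<dots> (Disj ?\<Psi> (BAll c t ?\<psi>c))" by (rule BAll_Disj_derives[OF wff_\<Psi> wff_\<psi>c t c(6,3)])
  also have "derives \<dots> (Disj ?\<Psi> (BAll x t \<psi>))"
    by (rule derives_Disj_mono[OF derives_refl[OF wff_\<Psi>] BAll_rename_derives[OF wff_\<psi> t c(1-4)]])
  also have "derives \<dots> (disjs (BAll x t \<psi> # \<psi>s'))" using wff_\<Psi> wff_\<psi> t by (simp add: Disj_commute_derives)
  finally have "derives ?\<Phi> (disjs (BAll x t \<psi> # \<psi>s'))" .
  moreover have "set (BAll x t \<psi> # \<psi>s') \<subseteq> G" "set \<phi>s' \<subseteq> F"
    using 1 ball unfolding \<phi>s'_def \<psi>s'_def by auto
  ultimately show False using cons unfolding inconsistent_def by blast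
qed

end

lemma finite_subset_Union_mono:
  assumes "\<And>m n. m \<le> n \<Longrightarrow> X m \<subseteq> X n" "finite A" "A \<subseteq> (\<Union>n. X n)"
  shows "\<exists>n. A \<subseteq> X (n :: nat)"
  using assms(2,3)
proof (induction rule: finite_induct)
  case (insert a A)
  then obtain m n where "A \<subseteq> X m" "a \<in> X n" by auto
  then have "insert a A \<subseteq> X (max m n)" using assms(1)[of m "max m n"] assms(1)[of n "max m n"] by auto
  then show ?case ..
qed simp

fun extend_pos :: "('f, 'p) fm \<Rightarrow> ('f, 'p) fm set \<Rightarrow> ('f, 'p) fm set \<Rightarrow> ('f, 'p) fm set \<times> ('f, 'p) fm set"
  where
  "extend_pos (Ex x \<psi>) F G =
     (let c = fresh (insert (Ex x \<psi>) F \<union> G)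
      in (insert (subst (Var(x := Var c)) \<psi>) (insert (Ex x \<psi>) F), G))"
| "extend_pos \<phi> F G = (insert \<phi> F, G)"

fun extend_neg :: "('f, 'p) fm \<Rightarrow> ('f, 'p) fm set \<Rightarrow> ('f, 'p) fm set \<Rightarrow> ('f, 'p) fm set \<times> ('f, 'p) fm set"
  where
  "extend_neg (BAll x t \<psi>) F G =
     (let c = fresh (F \<union> insert (BAll x t \<psi>) G)
      in (insert (Atom PIn [Var c, t]) F, insert (subst (Var(x := Var c)) \<psi>) (insert (BAll x t \<psi>) G)))"
| "extend_neg \<phi> F G = (F, insert \<phi> G)"

lemma extend_pos_mono: "F \<subseteq> fst (extend_pos \<phi> F G) \<and> G \<subseteq> snd (extend_pos \<phi> F G)"
  by (cases "(\<phi>, F, G)" rule: extend_pos.cases) (auto simp: Let_def)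

lemma extend_neg_mono: "F \<subseteq> fst (extend_neg \<phi> F G) \<and> G \<subseteq> snd (extend_neg \<phi> F G)"
  by (cases "(\<phi>, F, G)" rule: extend_neg.cases) (auto simp: Let_def)

lemma member_extend_pos: "\<phi> \<in> fst (extend_pos \<phi> F G)"
  by (cases "(\<phi>, F, G)" rule: extend_pos.cases) (auto simp: Let_def)

lemma member_extend_neg: "\<phi> \<in> snd (extend_neg \<phi> F G)"
  by (cases "(\<phi>, F, G)" rule: extend_neg.cases) (auto simp: Let_def)

context positivistic_calculus
begin

fun finite_consistent :: "('f, 'p) fm set \<times> ('f, 'p) fm set \<Rightarrow> bool" where
  "finite_consistent (F, G) \<longleftrightarrow>
     finite F \<and> finite G \<and> (\<forall>\<phi>\<in>F \<union> G. wff \<phi>) \<and> \<not> inconsistent F G"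

lemma finite_consistent_extend_pos:
  assumes "finite_consistent (F, G)" "wff \<phi>" "\<not> inconsistent (insert \<phi> F) G"
  shows "finite_consistent (extend_pos \<phi> F G)"
proof (cases "(\<phi>, F, G)" rule: extend_pos.cases)
  case (1 x \<psi>)
  let ?c = "fresh (insert \<phi> F \<union> G)"
  have "fresh_in ?c (insert \<phi> F \<union> G)" using assms(1) by (intro fresh_in_fresh) simp
  then have "\<not> inconsistent (insert (subst (Var(x := Var ?c)) \<psi>) (insert \<phi> F)) G"
    using assms 1 by (intro consistent_Ex_witness) auto
  moreover have "wff (subst (Var(x := Var ?c)) \<psi>)" using assms(2) 1 by (auto intro: fwf_subst)
  ultimately show ?thesis using assms 1 by (simp add: Let_def)
qed (use assms in simp_all)

lemma finite_consistent_extend_neg: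
  assumes "finite_consistent (F, G)" "wff \<phi>" "inconsistent (insert \<phi> F) G"
  shows "finite_consistent (extend_neg \<phi> F G)"
proof -
  have cons: "\<not> inconsistent F (insert \<phi> G)" using assms by (intro consistent_cut) auto
  show ?thesis
  proof (cases "(\<phi>, F, G)" rule: extend_neg.cases)
    case (1 x t \<psi>)
    let ?c = "fresh (F \<union> insert \<phi> G)"
    have "fresh_in ?c (F \<union> insert \<phi> G)" using assms(1) by (intro fresh_in_fresh) simp
    then have "\<not> inconsistent (insert (Atom PIn [Var ?c, t]) F)
        (insert (subst (Var(x := Var ?c)) \<psi>) (insert \<phi> G))"
      using assms(1,2) cons 1 by (intro consistent_BAll_counterexample) auto
    moreover have "wff (subst (Var(x := Var ?c)) \<psi>)" "twf FA t" using assms(2) 1 by (auto intro: fwf_subst)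
    ultimately show ?thesis using assms 1 by (simp add: Let_def)
  qed (use assms cons in simp_all)
qed

end

text \<open>Formulas are enumerated so that each one occurs infinitely often; F collects the
  formulas to be made true, G those to be made false.\<close>

locale henkin_construction = positivistic_calculus FA PA T
  for FA :: "'f::countable \<Rightarrow> nat" and PA :: "'p::countable \<Rightarrow> nat" and T +
  fixes \<chi> \<chi>' :: "('f, 'p) fm"
  assumes wff_T: "\<forall>c \<in> T. fwf FA PA (fst c) \<and> fwf FA PA (snd c)"
    and wff_\<chi>: "fwf FA PA \<chi>" and wff_\<chi>': "fwf FA PA \<chi>'"
    and not_derives: "\<not> derives \<chi> \<chi>'"
begin

definition enum :: "nat \<Rightarrow> ('f, 'p) fm" where
  "enum n = from_nat (fst (prod_decode n))"

lemma enum_prod_encode: "enum (prod_encode (to_nat \<phi>, k)) = \<phi>"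
  unfolding enum_def by simp

fun step :: "nat \<Rightarrow> ('f, 'p) fm set \<times> ('f, 'p) fm set \<Rightarrow> ('f, 'p) fm set \<times> ('f, 'p) fm set" where
  "step n (F, G) =
     (if \<not> wff (enum n) then (F, G)
      else if inconsistent (insert (enum n) F) G then extend_neg (enum n) F G
      else extend_pos (enum n) F G)"

primrec stage :: "nat \<Rightarrow> ('f, 'p) fm set \<times> ('f, 'p) fm set" where
  "stage 0 = ({\<chi>}, {\<chi>'})"
| "stage (Suc n) = step n (stage n)"

definition Pos :: "('f, 'p) fm set" where
  "Pos = (\<Union>n. fst (stage n))"

definition Neg :: "('f, 'p) fm set" where
  "Neg = (\<Union>n. snd (stage n))"

lemma finite_consistent_stage: "finite_consistent (stage n)"
proof (induction n)
  case 0
  have "\<not> inconsistent {\<chi>} {\<chi>'}"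
  proof
    assume "inconsistent {\<chi>} {\<chi>'}"
    then obtain \<phi>s \<psi>s where "set \<phi>s \<subseteq> {\<chi>}" "set \<psi>s \<subseteq> {\<chi>'}" "derives (conjs \<phi>s) (disjs \<psi>s)"
      unfolding inconsistent_def by blast
    then have "derives \<chi> \<chi>'"
      using wff_\<chi> wff_\<chi>' derives_conjsI[of \<chi> \<phi>s] disjs_derivesI[of \<chi>' \<psi>s]
      by (metis derives_refl derives_trans singletonD subsetD)
    with not_derives show False ..
  qed
  with wff_\<chi> wff_\<chi>' show ?case by simp
next
  case (Suc n)
  obtain F G where "stage n = (F, G)" by fastforce
  with Suc show ?case
    by (auto intro: finite_consistent_extend_pos finite_consistent_extend_neg)
qed

lemma stage_Suc_pos:
  "stage n = (F, G) \<Longrightarrow> enum n = \<phi> \<Longrightarrow> wff \<phi> \<Longrightarrow> \<not> inconsistent (insert \<phi> F) G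
    \<Longrightarrow> stage (Suc n) = extend_pos \<phi> F G"
  by simp

lemma stage_Suc_neg:
  "stage n = (F, G) \<Longrightarrow> enum n = \<phi> \<Longrightarrow> wff \<phi> \<Longrightarrow> inconsistent (insert \<phi> F) G
    \<Longrightarrow> stage (Suc n) = extend_neg \<phi> F G"
  by simp

lemma step_mono: "fst FG \<subseteq> fst (step n FG) \<and> snd FG \<subseteq> snd (step n FG)"
proof (cases FG)
  case (Pair F G)
  then show ?thesis using extend_pos_mono[of F "enum n" G] extend_neg_mono[of F "enum n" G] by auto
qed

lemma stage_mono: "m \<le> n \<Longrightarrow> fst (stage m) \<subseteq> fst (stage n) \<and> snd (stage m) \<subseteq> snd (stage n)"
proof (induction n rule: dec_induct)
  case (step n)
  then show ?case using step_mono[of "stage n" n] by (auto simp del: step.simps)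
qed simp

lemma stage_subset: "fst (stage n) \<subseteq> Pos" "snd (stage n) \<subseteq> Neg"
  unfolding Pos_def Neg_def by auto

lemma finite_subset_stage:
  assumes "finite A" "finite B" "A \<subseteq> Pos" "B \<subseteq> Neg"
  shows "\<exists>n. A \<subseteq> fst (stage n) \<and> B \<subseteq> snd (stage n)"
proof -
  obtain m n where "A \<subseteq> fst (stage m)" "B \<subseteq> snd (stage n)"
    using finite_subset_Union_mono[of "\<lambda>n. fst (stage n)" A] finite_subset_Union_mono[of "\<lambda>n. snd (stage n)" B]
      assms stage_mono unfolding Pos_def Neg_def by meson
  then have "A \<subseteq> fst (stage (max m n)) \<and> B \<subseteq> snd (stage (max m n))"
    using stage_mono[of m "max m n"] stage_mono[of n "max m n"] by auto
  then show ?thesis ..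
qed

lemma consistent_Pos_Neg: "\<not> inconsistent Pos Neg"
proof
  assume "inconsistent Pos Neg"
  then obtain \<phi>s \<psi>s where *: "set \<phi>s \<subseteq> Pos" "set \<psi>s \<subseteq> Neg" "derives (conjs \<phi>s) (disjs \<psi>s)"
    unfolding inconsistent_def by blast
  then obtain n where "set \<phi>s \<subseteq> fst (stage n)" "set \<psi>s \<subseteq> snd (stage n)"
    using finite_subset_stage by blast
  with *(3) have "inconsistent (fst (stage n)) (snd (stage n))" by (rule inconsistentI[rotated 2])
  with finite_consistent_stage[of n] show False by (cases "stage n") simp
qed

lemma wff_stage: "\<phi> \<in> fst (stage n) \<union> snd (stage n) \<Longrightarrow> wff \<phi>"
  using finite_consistent_stage[of n] by (cases "stage n") auto

lemma wff_Pos_Neg: "\<phi> \<in> Pos \<union> Neg \<Longrightarrow> wff \<phi>"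
  unfolding Pos_def Neg_def using wff_stage by blast

end

context henkin_construction
begin

lemma Pos_Neg_disjoint: "\<phi> \<in> Pos \<Longrightarrow> \<phi> \<notin> Neg"
proof
  assume "\<phi> \<in> Pos" "\<phi> \<in> Neg"
  moreover from this have "derives \<phi> \<phi>" using wff_Pos_Neg by (blast intro: derives_refl)
  ultimately have "inconsistent Pos Neg" by (rule inconsistent_if_derives)
  with consistent_Pos_Neg show False ..
qed

lemma consistent_insert_Pos:
  assumes "\<phi> \<in> Pos" "stage n = (F, G)" shows "\<not> inconsistent (insert \<phi> F) G"
proof
  assume "inconsistent (insert \<phi> F) G"
  moreover have "insert \<phi> F \<subseteq> Pos" "G \<subseteq> Neg" using assms stage_subset[of n] by auto
  ultimately have "inconsistent Pos Neg" by (rule inconsistent_mono)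
  with consistent_Pos_Neg show False ..
qed

lemma Pos_or_Neg:
  assumes "wff \<phi>" shows "\<phi> \<in> Pos \<or> \<phi> \<in> Neg"
proof -
  let ?n = "prod_encode (to_nat \<phi>, 0)"
  obtain F G where FG: "stage ?n = (F, G)" by fastforce
  show ?thesis
  proof (cases "inconsistent (insert \<phi> F) G")
    case True
    then have "\<phi> \<in> snd (stage (Suc ?n))"
      using stage_Suc_neg[OF FG enum_prod_encode assms] member_extend_neg by metis
    then show ?thesis using stage_subset by blast
  next
    case False
    then have "\<phi> \<in> fst (stage (Suc ?n))"
      using stage_Suc_pos[OF FG enum_prod_encode assms] member_extend_pos by metis
    then show ?thesis using stage_subset by blast
  qed
qed

lemma conjs_derives_Pos: "set \<phi>s \<subseteq> Pos \<Longrightarrow> derives (conjs \<phi>s) \<psi> \<Longrightarrow> \<psi> \<in> Pos"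
proof (rule ccontr)
  assume *: "set \<phi>s \<subseteq> Pos" "derives (conjs \<phi>s) \<psi>" "\<psi> \<notin> Pos"
  then have "\<psi> \<in> Neg" using Pos_or_Neg[OF derives_wffD2[OF *(2)]] by simp
  moreover have "derives \<psi> (disjs [\<psi>])" using derives_Disj1[of \<psi> Bot] derives_wffD2[OF *(2)] by simp
  with *(2) have "derives (conjs \<phi>s) (disjs [\<psi>])" by (rule derives_trans)
  ultimately show False using consistent_Pos_Neg *(1) inconsistentI[of "\<phi>s" Pos "[\<psi>]"] by simp
qed

lemma Pos_derives: "\<phi> \<in> Pos \<Longrightarrow> derives \<phi> \<psi> \<Longrightarrow> \<psi> \<in> Pos"
  using conjs_derives_Pos[of "[\<phi>]" \<psi>] derives_trans[OF Conj_derives1[of \<phi> Top]] derives_wffD1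
  by simp

lemma Top_in_Pos: "Top \<in> Pos"
  using conjs_derives_Pos[of "[]"] derives_refl by simp

lemma Bot_notin_Pos: "Bot \<notin> Pos"
proof
  assume "Bot \<in> Pos"
  then have "inconsistent Pos Neg"
    by (intro inconsistentI[of "[Bot]" _ "[]"]) (simp_all add: Conj_derives1)
  with consistent_Pos_Neg show False ..
qed

lemma Conj_in_Pos_iff:
  assumes "wff (Conj \<phi> \<psi>)" shows "Conj \<phi> \<psi> \<in> Pos \<longleftrightarrow> \<phi> \<in> Pos \<and> \<psi> \<in> Pos"
proof
  assume "Conj \<phi> \<psi> \<in> Pos"
  with assms show "\<phi> \<in> Pos \<and> \<psi> \<in> Pos"
    using Pos_derives[OF _ Conj_derives1[of \<phi> \<psi>]] Pos_derives[OF _ Conj_derives2[of \<phi> \<psi>]] by simp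
next
  assume "\<phi> \<in> Pos \<and> \<psi> \<in> Pos"
  moreover have "derives (conjs [\<phi>, \<psi>]) (Conj \<phi> \<psi>)"
    using assms by (intro derives_ConjI conjs_derives_member) auto
  ultimately show "Conj \<phi> \<psi> \<in> Pos" by (intro conjs_derives_Pos[of "[\<phi>, \<psi>]"]) auto
qed

lemma Disj_in_Pos_iff:
  assumes wff: "wff (Disj \<phi> \<psi>)" shows "Disj \<phi> \<psi> \<in> Pos \<longleftrightarrow> \<phi> \<in> Pos \<or> \<psi> \<in> Pos"
proof
  assume Disj: "Disj \<phi> \<psi> \<in> Pos"
  show "\<phi> \<in> Pos \<or> \<psi> \<in> Pos"
  proof (rule ccontr)
    assume "\<not> (\<phi> \<in> Pos \<or> \<psi> \<in> Pos)"
    then have Neg: "set [\<phi>, \<psi>] \<subseteq> Neg" using wff Pos_or_Neg by auto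
    have "derives (conjs [Disj \<phi> \<psi>]) (Disj \<phi> \<psi>)" using wff by (simp add: Conj_derives1)
    also have "derives \<dots> (disjs [\<phi>, \<psi>])"
      using wff by (intro Disj_derivesI member_derives_disjs) auto
    finally have "inconsistent Pos Neg"
      using Disj Neg by (intro inconsistentI[of "[Disj \<phi> \<psi>]" _ "[\<phi>, \<psi>]"]) auto
    with consistent_Pos_Neg show False ..
  qed
next
  assume "\<phi> \<in> Pos \<or> \<psi> \<in> Pos"
  with wff show "Disj \<phi> \<psi> \<in> Pos"
    using Pos_derives[OF _ derives_Disj1[of \<phi> \<psi>]] Pos_derives[OF _ derives_Disj2[of \<phi> \<psi>]] by auto
qed

definition witness :: "nat \<Rightarrow> nat" where
  "witness n = fresh (insert (enum n) (fst (stage n)) \<union> snd (stage n))"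

lemma fresh_in_witness: "fresh_in (witness n) (insert (enum n) (fst (stage n)) \<union> snd (stage n))"
proof -
  obtain F G where "stage n = (F, G)" by fastforce
  with finite_consistent_stage[of n] show ?thesis unfolding witness_def by (intro fresh_in_fresh) simp
qed

lemma witness_in_stage:
  assumes "enum n = Ex x \<psi>" "Ex x \<psi> \<in> Pos"
  shows "subst (Var(x := Var (witness n))) \<psi> \<in> fst (stage (Suc n))"
proof -
  obtain F G where FG: "stage n = (F, G)" by fastforce
  have "stage (Suc n) = extend_pos (Ex x \<psi>) F G"
  proof (rule stage_Suc_pos[OF FG assms(1)])
    show "wff (Ex x \<psi>)" using assms(2) wff_Pos_Neg by blast
  qed (rule consistent_insert_Pos[OF assms(2) FG])
  moreover have "witness n = fresh (insert (Ex x \<psi>) F \<union> G)" unfolding witness_def using FG assms(1) by simp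
  moreover have "subst (Var(x := Var (fresh (insert (Ex x \<psi>) F \<union> G)))) \<psi> \<in> fst (extend_pos (Ex x \<psi>) F G)"
    by (simp add: Let_def)
  ultimately show ?thesis by (simp only:)
qed

lemma Pos_Ex_witness:
  assumes "Ex x \<psi> \<in> Pos" shows "\<exists>c. c \<notin> bv \<psi> \<and> subst (Var(x := Var c)) \<psi> \<in> Pos"
proof -
  let ?n = "prod_encode (to_nat (Ex x \<psi>), 0)"
  have "witness ?n \<notin> bv \<psi>" using fresh_in_witness[of ?n] by (simp add: enum_prod_encode fresh_in_def)
  moreover have "subst (Var(x := Var (witness ?n))) \<psi> \<in> Pos"
    using witness_in_stage[OF enum_prod_encode assms] stage_subset by blast
  ultimately show ?thesis by blast
qed

lemma Neg_BAll_counterexample: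
  assumes "BAll x t \<psi> \<in> Neg"
  shows "\<exists>c. c \<notin> bv \<psi> \<and> Atom PIn [Var c, t] \<in> Pos \<and> subst (Var(x := Var c)) \<psi> \<in> Neg"
proof -
  let ?\<phi> = "BAll x t \<psi>" and ?n = "prod_encode (to_nat (BAll x t \<psi>), 0)"
  obtain F G where FG: "stage ?n = (F, G)" by fastforce
  let ?c = "fresh (F \<union> insert ?\<phi> G)"
  have "finite F" "finite G" using finite_consistent_stage[of ?n] FG by simp_all
  then have fresh: "?c \<notin> bv \<psi>" using fresh_in_fresh[of "F \<union> insert ?\<phi> G"] by (simp add: fresh_in_def)
  have wff: "wff ?\<phi>" using assms wff_Pos_Neg by blast
  have "inconsistent (insert ?\<phi> F) G"
  proof (rule ccontr)
    assume "\<not> inconsistent (insert ?\<phi> F) G"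
    then have "?\<phi> \<in> fst (stage (Suc ?n))"
      using stage_Suc_pos[OF FG enum_prod_encode wff] member_extend_pos by metis
    with assms show False using stage_subset Pos_Neg_disjoint by blast
  qed
  then have "stage (Suc ?n) = extend_neg ?\<phi> F G" by (rule stage_Suc_neg[OF FG enum_prod_encode wff])
  then have "Atom PIn [Var ?c, t] \<in> Pos \<and> subst (Var(x := Var ?c)) \<psi> \<in> Neg"
    using stage_subset[of "Suc ?n"] by (auto simp del: stage.simps simp: Let_def)
  with fresh show ?thesis by blast
qed

end

context henkin_construction
begin

lemma Eq_refl_in_Pos: "twf FA a \<Longrightarrow> Atom PEq [a, a] \<in> Pos"
  using Pos_derives[OF Top_in_Pos derives_Eq_refl] .

lemma Eq_sym_in_Pos: "Atom PEq [a, b] \<in> Pos \<Longrightarrow> Atom PEq [b, a] \<in> Pos"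
  using wff_Pos_Neg[of "Atom PEq [a, b]"] by (auto intro: Pos_derives Eq_sym_derives)

lemma Eq_trans_in_Pos:
  assumes "Atom PEq [a, b] \<in> Pos" "Atom PEq [b, c] \<in> Pos" shows "Atom PEq [a, c] \<in> Pos"
proof -
  have t: "twf FA a" "twf FA b" "twf FA c" using assms wff_Pos_Neg by fastforce+
  with assms have "Conj (Atom PEq [a, b]) (Atom PEq [b, c]) \<in> Pos" by (subst Conj_in_Pos_iff) auto
  then show ?thesis using Pos_derives Eq_trans_derives[OF t] by blast
qed

lemma Ex_Eq_in_Pos: "twf FA t \<Longrightarrow> w \<notin> tvars t \<Longrightarrow> Ex w (Atom PEq [Var w, t]) \<in> Pos"
  using derives_trans[OF derives_Ex_Eq[of Top t w] derives_Ex_mono[OF Conj_derives2]]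
  by (intro Pos_derives[OF Top_in_Pos]) simp_all

text \<open>Each formula is enumerated infinitely often, so the Henkin axiom for the existential
  formula (\<exists>w. w = x) supplies infinitely many witnesses, each fresh for the earlier ones.\<close>

lemma infinite_Eq_class: "infinite {c. vEq c x \<in> Pos}"
proof -
  define w where "w = Suc x"
  let ?\<phi> = "Ex w (vEq w x) :: ('f, 'p) fm"
  define n where "n k = prod_encode (to_nat ?\<phi>, k)" for k
  have \<phi>: "?\<phi> \<in> Pos" using Ex_Eq_in_Pos[of "Var x" w] unfolding w_def by simp
  have enum: "enum (n k) = ?\<phi>" for k unfolding n_def by (rule enum_prod_encode)
  have witness: "vEq (witness (n k)) x \<in> fst (stage (Suc (n k)))" for k
    using witness_in_stage[OF enum \<phi>] unfolding w_def by simp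
  have distinct: "witness (n k) \<noteq> witness (n k')" if "n k < n k'" for k k'
  proof -
    have "vEq (witness (n k)) x \<in> fst (stage (n k'))"
      using witness[of k] stage_mono[of "Suc (n k)" "n k'"] that by auto
    then have "witness (n k') \<notin> fv (vEq (witness (n k)) x :: ('f, 'p) fm)"
      using fresh_in_witness[of "n k'"] unfolding fresh_in_def by blast
    then show ?thesis by auto
  qed
  have "inj (witness \<circ> n)"
  proof (rule injI)
    fix k k' assume eq: "(witness \<circ> n) k = (witness \<circ> n) k'"
    show "k = k'"
    proof (rule ccontr)
      assume "k \<noteq> k'"
      then have "n k \<noteq> n k'" unfolding n_def by (simp add: prod_encode_eq)
      then consider "n k < n k'" | "n k' < n k" by linarith
      then show False using distinct[of k k'] distinct[of k' k] eq by cases auto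
    qed
  qed
  then have "infinite (range (witness \<circ> n))" using finite_imageD infinite_UNIV_nat by blast
  moreover have "range (witness \<circ> n) \<subseteq> {c. vEq c x \<in> Pos}" using witness stage_subset by fastforce
  ultimately show ?thesis using infinite_super by blast
qed

lemma Eq_class_avoid: "finite S \<Longrightarrow> \<exists>b. vEq b x \<in> Pos \<and> b \<notin> S"
  using infinite_Eq_class[of x] by (metis (mono_tags, lifting) finite_subset mem_Collect_eq subsetI)

end

lemma map_upt_nth: "map (\<lambda>j. if j < length ss then f (ss ! j) else g j) [0..<length ss] = map f ss"
  by (rule nth_equalityI) auto

context henkin_construction
begin

text \<open>The elements of the term model are the least variables of the classes of variables modulo
  the equations in Pos.  Each term equals some variable, by the Henkin witness of
  (\<exists>w. w = t), and is evaluated to the class of that variable.\<close>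

definition rep :: "nat \<Rightarrow> nat" where
  "rep x = (LEAST y. vEq y x \<in> Pos)"

lemma Eq_rep_in_Pos: "vEq (rep x) x \<in> Pos"
  unfolding rep_def by (rule LeastI[of _ x]) (rule Eq_refl_in_Pos, simp)

lemma rep_eq_iff: "rep x = rep y \<longleftrightarrow> vEq x y \<in> Pos"
proof
  assume "rep x = rep y"
  then show "vEq x y \<in> Pos" using Eq_rep_in_Pos[of x] Eq_rep_in_Pos[of y] by (metis Eq_sym_in_Pos Eq_trans_in_Pos)
next
  assume h: "vEq x y \<in> Pos"
  have e: "(\<lambda>z. vEq z x \<in> Pos) = (\<lambda>z. vEq z y \<in> Pos)"
    using h by (intro ext iffI) (auto intro: Eq_trans_in_Pos Eq_sym_in_Pos)
  show "rep x = rep y" unfolding rep_def by (simp only: e)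
qed

lemma rep_rep: "rep (rep x) = rep x"
  using rep_eq_iff Eq_rep_in_Pos by blast

definition val :: "'f trm \<Rightarrow> nat" where
  "val s = rep (SOME v. Atom PEq [Var v, s] \<in> Pos)"

lemma Eq_val_in_Pos: assumes s: "twf FA s" shows "Atom PEq [Var (val s), s] \<in> Pos"
proof -
  obtain w where w: "w \<notin> tvars s" using ex_fresh_var[of "tvars s"] by auto
  have "Ex w (Atom PEq [Var w, s]) \<in> Pos" by (rule Ex_Eq_in_Pos[OF s w])
  then obtain c where "subst (Var(w := Var c)) (Atom PEq [Var w, s]) \<in> Pos"
    using Pos_Ex_witness by blast
  moreover have "tsubst (Var(w := Var c)) s = s" by (rule tsubst_upd_fresh[OF w])
  ultimately have "Atom PEq [Var c, s] \<in> Pos" by simp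
  then have ex: "\<exists>v. Atom PEq [Var v, s] \<in> Pos" by blast
  define v where "v = (SOME v. Atom PEq [Var v, s] \<in> Pos)"
  have v: "Atom PEq [Var v, s] \<in> Pos" unfolding v_def using someI_ex[OF ex] .
  have "val s = rep v" unfolding val_def v_def ..
  then show ?thesis using Eq_rep_in_Pos[of v] v Eq_trans_in_Pos by metis
qed

lemma rep_val: "twf FA s \<Longrightarrow> rep (val s) = val s"
  unfolding val_def by (simp add: rep_rep)

lemma val_cong: assumes "twf FA s" "twf FA s'" "Atom PEq [s, s'] \<in> Pos" shows "val s = val s'"
proof -
  have "vEq (val s) (val s') \<in> Pos"
    using Eq_val_in_Pos[OF assms(1)] Eq_val_in_Pos[OF assms(2)] assms(3) by (meson Eq_sym_in_Pos Eq_trans_in_Pos)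
  then have "rep (val s) = rep (val s')" using rep_eq_iff by blast
  then show ?thesis using rep_val assms by metis
qed

lemma val_Var: "val (Var y) = rep y"
proof -
  have "vEq (val (Var y)) y \<in> Pos" using Eq_val_in_Pos[of "Var y"] by simp
  then have "rep (val (Var y)) = rep y" using rep_eq_iff by blast
  then show ?thesis using rep_val[of "Var y"] by simp
qed

text \<open>Equal terms may be substituted in Pos one variable at a time, by P23.\<close>

lemma Pos_subst_Eq:
  assumes WA: "wff (Atom p ts)" and t1: "\<And>v. twf FA (\<tau>1 v)" and t2: "\<And>v. twf FA (\<tau>2 v)"
    and eq: "\<forall>v\<in>fv (Atom p ts). Atom PEq [\<tau>1 v, \<tau>2 v] \<in> Pos"
    and h: "subst \<tau>1 (Atom p ts) \<in> Pos"
  shows "subst \<tau>2 (Atom p ts) \<in> Pos"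
proof -
  let ?A = "Atom p ts"
  define tS where "tS S v = (if v \<in> S then \<tau>2 v else \<tau>1 v)" for S v
  have tw: "twf FA (tS S v)" for S v using t1 t2 unfolding tS_def by auto
  have "finite S \<Longrightarrow> S \<subseteq> fv ?A \<Longrightarrow> subst (tS S) ?A \<in> Pos" for S
  proof (induction S rule: finite_induct)
    case empty
    have "tS {} = \<tau>1" unfolding tS_def by auto
    then show ?case using h by simp
  next
    case (insert z S)
    have IH: "subst (tS S) ?A \<in> Pos" using insert by auto
    have e1: "(tS S)(z := \<tau>1 z) = tS S" using insert unfolding tS_def by auto
    have e2: "(tS S)(z := \<tau>2 z) = tS (insert z S)" unfolding tS_def by auto
    have z: "Atom PEq [\<tau>1 z, \<tau>2 z] \<in> Pos" using eq insert by auto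
    have d: "derives (Conj (Atom PEq [\<tau>1 z, \<tau>2 z]) (subst ((tS S)(z := \<tau>1 z)) ?A)) (subst ((tS S)(z := \<tau>2 z)) ?A)"
      by (rule Eq_subst_derives) (use WA t1 t2 tw in auto)
    have "Conj (Atom PEq [\<tau>1 z, \<tau>2 z]) (subst (tS S) ?A) \<in> Pos"
    proof (subst Conj_in_Pos_iff)
      show "wff (Conj (Atom PEq [\<tau>1 z, \<tau>2 z]) (subst (tS S) ?A))"
        using WA fwf_subst[OF WA tw[of S]] t1 t2 by simp
      show "Atom PEq [\<tau>1 z, \<tau>2 z] \<in> Pos \<and> subst (tS S) ?A \<in> Pos" using z IH by simp
    qed
    then show ?case using Pos_derives d e1 e2 by simp
  qed
  then have "subst (tS (fv ?A)) ?A \<in> Pos" by simp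
  moreover have "subst (tS (fv ?A)) ?A = subst \<tau>2 ?A"
    by (rule subst_cong) (simp add: tS_def)
  ultimately show ?thesis by metis
qed

text \<open>An atom is the instance of the pattern p(0, \<dots>, n-1) at its arguments; substituting for
  each argument a variable naming its value does not change membership in Pos.\<close>

lemma Atom_in_Pos_val:
  assumes WA: "wff (Atom p ss)"
  shows "Atom p ss \<in> Pos \<longleftrightarrow> Atom p (map (\<lambda>s. Var (val s)) ss) \<in> Pos"
proof -
  let ?n = "length ss"
  let ?A = "Atom p (map Var [0..<?n]) :: ('f, 'p) fm"
  have tw: "\<forall>s\<in>set ss. twf FA s" using WA by (simp add: list_all_iff)
  have WA': "wff ?A" using WA by (simp add: list_all_iff)
  define \<tau>1 where "\<tau>1 j = (if j < ?n then ss ! j else Var j)" for j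
  define \<tau>2 where "\<tau>2 j = (if j < ?n then Var (val (ss ! j)) else Var j :: 'f trm)" for j
  have t1: "\<And>v. twf FA (\<tau>1 v)" unfolding \<tau>1_def using tw by auto
  have t2: "\<And>v. twf FA (\<tau>2 v)" unfolding \<tau>2_def by auto
  have e1: "subst \<tau>1 ?A = Atom p ss"
    using map_upt_nth[of ss "\<lambda>s. s" Var] unfolding \<tau>1_def by (simp add: comp_def)
  have e2: "subst \<tau>2 ?A = Atom p (map (\<lambda>s. Var (val s)) ss)"
    using map_upt_nth[of ss "\<lambda>s. Var (val s)" Var] unfolding \<tau>2_def by (simp add: comp_def)
  have eq12: "\<forall>v\<in>fv ?A. Atom PEq [\<tau>1 v, \<tau>2 v] \<in> Pos"
    unfolding \<tau>1_def \<tau>2_def using tw by (auto intro!: Eq_sym_in_Pos Eq_val_in_Pos)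
  have eq21: "\<forall>v\<in>fv ?A. Atom PEq [\<tau>2 v, \<tau>1 v] \<in> Pos"
    unfolding \<tau>1_def \<tau>2_def using tw by (auto intro!: Eq_val_in_Pos)
  show ?thesis
    using Pos_subst_Eq[OF WA' t1 t2 eq12] Pos_subst_Eq[OF WA' t2 t1 eq21] e1 e2 by auto
qed

lemma val_Fn_val:
  assumes tF: "twf FA (Fn f ss)"
  shows "val (Fn f (map (\<lambda>s. Var (val s)) ss)) = val (Fn f ss)"
proof -
  let ?n = "length ss"
  let ?X = "Fn f (map (\<lambda>s. Var (val s)) ss)"
  let ?A = "Atom PEq [Var ?n, Fn f (map Var [0..<?n])] :: ('f, 'p) fm"
  have tw: "\<forall>s\<in>set ss. twf FA s" and len: "?n = FA f" using tF by (auto simp: list_all_iff)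
  have tX: "twf FA ?X" using len by (simp add: list_all_iff)
  have WA': "wff ?A" using len by (simp add: list_all_iff)
  define \<tau>1 where "\<tau>1 j = (if j < ?n then Var (val (ss ! j)) else if j = ?n then ?X else Var j)" for j
  define \<tau>2 where "\<tau>2 j = (if j < ?n then ss ! j else if j = ?n then ?X else Var j)" for j
  have t1: "\<And>v. twf FA (\<tau>1 v)" unfolding \<tau>1_def using tX by auto
  have t2: "\<And>v. twf FA (\<tau>2 v)" unfolding \<tau>2_def using tw tX by auto
  have e1: "subst \<tau>1 ?A = Atom PEq [?X, ?X]"
    using map_upt_nth[of ss "\<lambda>s. Var (val s)" "\<lambda>j. if j = ?n then ?X else Var j"] unfolding \<tau>1_def
    by (simp add: comp_def)
  have e2: "subst \<tau>2 ?A = Atom PEq [?X, Fn f ss]"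
    using map_upt_nth[of ss "\<lambda>s. s" "\<lambda>j. if j = ?n then ?X else Var j"] unfolding \<tau>2_def
    by (simp add: comp_def)
  have eq12: "\<forall>v\<in>fv ?A. Atom PEq [\<tau>1 v, \<tau>2 v] \<in> Pos"
    unfolding \<tau>1_def \<tau>2_def using tw tX by (auto intro!: Eq_val_in_Pos Eq_refl_in_Pos)
  have "Atom PEq [?X, ?X] \<in> Pos" by (rule Eq_refl_in_Pos[OF tX])
  then have "Atom PEq [?X, Fn f ss] \<in> Pos" using Pos_subst_Eq[OF WA' t1 t2 eq12] e1 e2 by simp
  then show ?thesis using val_cong tX tF by blast
qed

definition term_model :: "('f, 'p) struc" where
  "term_model = Struc (range rep) (\<lambda>f as. val (Fn f (map Var as))) (\<lambda>p as. Atom p (map Var as) \<in> Pos)"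

lemma term_model_simps[simp]: "dom term_model = range rep" "fint term_model f as = val (Fn f (map Var as))"
  "pint term_model p as = (Atom p (map Var as) \<in> Pos)"
  unfolding term_model_def by simp_all

lemma teval_term_model: "twf FA t \<Longrightarrow> teval term_model (\<lambda>v. rep (\<rho> v)) t = val (tsubst (\<lambda>v. Var (\<rho> v)) t)"
proof (induction t)
  case (Var x) then show ?case by (simp add: val_Var)
next
  case (Fn f ts)
  let ?\<sigma> = "\<lambda>v. Var (\<rho> v)"
  have IH: "map (teval term_model (\<lambda>v. rep (\<rho> v))) ts = map (\<lambda>t. val (tsubst ?\<sigma> t)) ts"
    using Fn by (auto simp: list_all_iff)
  have tF: "twf FA (Fn f (map (tsubst ?\<sigma>) ts))"
    using twf_tsubst[OF Fn.prems, of ?\<sigma>] by simp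
  have "teval term_model (\<lambda>v. rep (\<rho> v)) (Fn f ts) = val (Fn f (map Var (map (teval term_model (\<lambda>v. rep (\<rho> v))) ts)))"
    by simp
  also have "\<dots> = val (Fn f (map Var (map (\<lambda>t. val (tsubst ?\<sigma> t)) ts)))" by (simp only: IH)
  also have "\<dots> = val (Fn f (map (\<lambda>s. Var (val s)) (map (tsubst ?\<sigma>) ts)))" by (simp add: comp_def)
  also have "\<dots> = val (Fn f (map (tsubst ?\<sigma>) ts))" by (rule val_Fn_val[OF tF])
  finally show ?case by simp
qed

end

definition safe_renaming :: "('f, 'p) fm \<Rightarrow> (nat \<Rightarrow> nat) \<Rightarrow> bool" where
  "safe_renaming \<phi> \<rho> \<longleftrightarrow> (\<forall>v\<in>fv \<phi>. \<rho> v = v \<or> \<rho> v \<notin> bv \<phi>)"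

lemma substble_safe_renaming: "safe_renaming \<phi> \<rho> \<Longrightarrow> substble (\<lambda>v. Var (\<rho> v)) \<phi>"
  unfolding safe_renaming_def by (rule substble_if_bv_disjoint) auto

lemma safe_renaming_bound_var:
  "safe_renaming \<phi> \<rho> \<Longrightarrow> x \<in> bv \<phi> \<Longrightarrow> v \<in> fv \<phi> \<Longrightarrow> v \<noteq> x \<Longrightarrow> \<rho> v \<noteq> x"
  unfolding safe_renaming_def by auto

lemma safe_renaming_upd:
  "safe_renaming \<phi> \<rho> \<Longrightarrow> fv \<psi> \<subseteq> insert x (fv \<phi>) \<Longrightarrow> bv \<psi> \<subseteq> bv \<phi> \<Longrightarrow> b = x \<or> b \<notin> bv \<psi>
    \<Longrightarrow> safe_renaming \<psi> (\<rho>(x := b))"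
  unfolding safe_renaming_def by auto

lemma subst_Var_upd: "(\<lambda>v. Var (\<rho> v))(x := Var y) = (\<lambda>v. Var ((\<rho>(x := y)) v))"
  by auto

lemma subst_renaming_upd:
  assumes "\<forall>v\<in>fv \<psi> - {x}. \<rho> v \<noteq> x" "substble (\<lambda>v. Var ((\<rho>(x := x)) v)) \<psi>"
  shows "subst (Var(x := Var c)) (subst (\<lambda>v. Var ((\<rho>(x := x)) v)) \<psi>) = subst (\<lambda>v. Var ((\<rho>(x := c)) v)) \<psi>"
  unfolding subst_subst[OF assms(2)] by (rule subst_cong) (use assms(1) in auto)

context henkin_construction
begin

lemma truth_Atom:
  assumes "wff (Atom p ts)"
  shows "sat term_model (\<lambda>v. rep (\<rho> v)) (Atom p ts) \<longleftrightarrow> subst (\<lambda>v. Var (\<rho> v)) (Atom p ts) \<in> Pos"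
proof -
  let ?\<sigma> = "\<lambda>v. Var (\<rho> v)"
  have IH: "map (teval term_model (\<lambda>v. rep (\<rho> v))) ts = map (\<lambda>t. val (tsubst ?\<sigma> t)) ts"
    using assms teval_term_model by (auto simp: list_all_iff)
  have "sat term_model (\<lambda>v. rep (\<rho> v)) (Atom p ts)
      \<longleftrightarrow> Atom p (map Var (map (teval term_model (\<lambda>v. rep (\<rho> v))) ts)) \<in> Pos" by simp
  also have "\<dots> \<longleftrightarrow> Atom p (map (\<lambda>s. Var (val s)) (map (tsubst ?\<sigma>) ts)) \<in> Pos"
    by (simp only: IH map_map comp_def)
  also have "\<dots> \<longleftrightarrow> Atom p (map (tsubst ?\<sigma>) ts) \<in> Pos"
    using assms by (intro Atom_in_Pos_val[symmetric]) (simp add: list_all_iff twf_tsubst)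
  finally show ?thesis by simp
qed

lemma truth_quantifier_body:
  assumes IH: "\<And>\<rho>. safe_renaming \<psi> \<rho>
      \<Longrightarrow> sat term_model (\<lambda>v. rep (\<rho> v)) \<psi> \<longleftrightarrow> subst (\<lambda>v. Var (\<rho> v)) \<psi> \<in> Pos"
    and safe: "safe_renaming \<phi> \<rho>"
    and \<phi>: "x \<in> bv \<phi>" "fv \<psi> \<subseteq> insert x (fv \<phi>)" "bv \<psi> \<subseteq> bv \<phi>"
    and b: "b \<notin> bv \<psi>"
  shows "sat term_model ((\<lambda>v. rep (\<rho> v))(x := rep b)) \<psi>
     \<longleftrightarrow> subst (Var(x := Var b)) (subst (\<lambda>v. Var ((\<rho>(x := x)) v)) \<psi>) \<in> Pos"
proof -
  have x: "\<forall>v\<in>fv \<psi> - {x}. \<rho> v \<noteq> x" using safe_renaming_bound_var[OF safe \<phi>(1)] \<phi>(2) by auto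
  have upd: "safe_renaming \<psi> (\<rho>(x := c))" if "c = x \<or> c \<notin> bv \<psi>" for c
    using safe_renaming_upd[OF safe \<phi>(2,3) that] .
  have "substble (\<lambda>v. Var ((\<rho>(x := x)) v)) \<psi>" using upd substble_safe_renaming by blast
  then have "subst (Var(x := Var b)) (subst (\<lambda>v. Var ((\<rho>(x := x)) v)) \<psi>)
      = subst (\<lambda>v. Var ((\<rho>(x := b)) v)) \<psi>" by (rule subst_renaming_upd[OF x])
  moreover have "(\<lambda>v. rep (\<rho> v))(x := rep b) = (\<lambda>v. rep ((\<rho>(x := b)) v))" by auto
  ultimately show ?thesis using IH[OF upd] b by (simp only:) simp
qed

lemma truth_Ex:
  assumes wff: "wff \<psi>" and safe: "safe_renaming (Ex x \<psi>) \<rho>"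
    and IH: "\<And>\<rho>. safe_renaming \<psi> \<rho>
      \<Longrightarrow> sat term_model (\<lambda>v. rep (\<rho> v)) \<psi> \<longleftrightarrow> subst (\<lambda>v. Var (\<rho> v)) \<psi> \<in> Pos"
  shows "sat term_model (\<lambda>v. rep (\<rho> v)) (Ex x \<psi>) \<longleftrightarrow> subst (\<lambda>v. Var (\<rho> v)) (Ex x \<psi>) \<in> Pos"
proof -
  let ?\<psi>' = "subst (\<lambda>v. Var ((\<rho>(x := x)) v)) \<psi>"
  have body: "sat term_model ((\<lambda>v. rep (\<rho> v))(x := rep b)) \<psi>
      \<longleftrightarrow> subst (Var(x := Var b)) ?\<psi>' \<in> Pos" if "b \<notin> bv \<psi>" for b
    using truth_quantifier_body[OF IH safe _ _ _ that] by auto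
  have wff': "wff ?\<psi>'" using wff by (auto intro: fwf_subst)
  show ?thesis
  proof
    assume "sat term_model (\<lambda>v. rep (\<rho> v)) (Ex x \<psi>)"
    then obtain y where "sat term_model ((\<lambda>v. rep (\<rho> v))(x := rep y)) \<psi>" by auto
    moreover obtain b where b: "vEq b y \<in> Pos" "b \<notin> bv \<psi>" using Eq_class_avoid[of "bv \<psi>" y] by auto
    ultimately have "subst (Var(x := Var b)) ?\<psi>' \<in> Pos" using body rep_eq_iff by metis
    then have "Ex x ?\<psi>' \<in> Pos"
      using derives_Ex_intro[OF wff' substble_rename] b(2) by (auto intro: Pos_derives)
    then show "subst (\<lambda>v. Var (\<rho> v)) (Ex x \<psi>) \<in> Pos" by (simp add: subst_Var_upd)
  next
    assume "subst (\<lambda>v. Var (\<rho> v)) (Ex x \<psi>) \<in> Pos"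
    then have "Ex x ?\<psi>' \<in> Pos" by (simp add: subst_Var_upd)
    then obtain c where "c \<notin> bv \<psi>" "subst (Var(x := Var c)) ?\<psi>' \<in> Pos"
      using Pos_Ex_witness by fastforce
    then show "sat term_model (\<lambda>v. rep (\<rho> v)) (Ex x \<psi>)" using body by auto
  qed
qed

lemma In_val_in_Pos_iff:
  "twf FA t \<Longrightarrow> Atom PIn [Var a, t] \<in> Pos \<longleftrightarrow> Atom PIn [Var (rep a), Var (val t)] \<in> Pos"
  using Atom_in_Pos_val[of PIn "[Var a, t]"] by (simp add: val_Var)

lemma truth_BAll:
  assumes wff: "wff \<psi>" "twf FA t" and safe: "safe_renaming (BAll x t \<psi>) \<rho>"
    and IH: "\<And>\<rho>. safe_renaming \<psi> \<rho>
      \<Longrightarrow> sat term_model (\<lambda>v. rep (\<rho> v)) \<psi> \<longleftrightarrow> subst (\<lambda>v. Var (\<rho> v)) \<psi> \<in> Pos"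
  shows "sat term_model (\<lambda>v. rep (\<rho> v)) (BAll x t \<psi>) \<longleftrightarrow> subst (\<lambda>v. Var (\<rho> v)) (BAll x t \<psi>) \<in> Pos"
proof -
  let ?\<psi>' = "subst (\<lambda>v. Var ((\<rho>(x := x)) v)) \<psi>" and ?t' = "tsubst (\<lambda>v. Var (\<rho> v)) t"
  have body: "sat term_model ((\<lambda>v. rep (\<rho> v))(x := rep b)) \<psi>
      \<longleftrightarrow> subst (Var(x := Var b)) ?\<psi>' \<in> Pos" if "b \<notin> bv \<psi>" for b
    using truth_quantifier_body[OF IH safe _ _ _ that] by auto
  have wff': "wff ?\<psi>'" "twf FA ?t'" using wff by (auto intro: fwf_subst twf_tsubst)
  have subst_BAll: "subst (\<lambda>v. Var (\<rho> v)) (BAll x t \<psi>) = BAll x ?t' ?\<psi>'" by (simp add: subst_Var_upd)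
  have sat_BAll: "sat term_model (\<lambda>v. rep (\<rho> v)) (BAll x t \<psi>) \<longleftrightarrow>
      (\<forall>y. Atom PIn [Var (rep y), Var (val ?t')] \<in> Pos \<longrightarrow> sat term_model ((\<lambda>v. rep (\<rho> v))(x := rep y)) \<psi>)"
    using teval_term_model[OF wff(2)] by auto
  show ?thesis
  proof
    assume sat: "sat term_model (\<lambda>v. rep (\<rho> v)) (BAll x t \<psi>)"
    show "subst (\<lambda>v. Var (\<rho> v)) (BAll x t \<psi>) \<in> Pos"
    proof (rule ccontr)
      assume "subst (\<lambda>v. Var (\<rho> v)) (BAll x t \<psi>) \<notin> Pos"
      moreover have "wff (BAll x ?t' ?\<psi>')" using wff' by simp
      ultimately have "BAll x ?t' ?\<psi>' \<in> Neg" using Pos_or_Neg subst_BAll by metis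
      then obtain c where c: "c \<notin> bv \<psi>" "Atom PIn [Var c, ?t'] \<in> Pos" "subst (Var(x := Var c)) ?\<psi>' \<in> Neg"
        using Neg_BAll_counterexample by fastforce
      then have "sat term_model ((\<lambda>v. rep (\<rho> v))(x := rep c)) \<psi>"
        using sat sat_BAll In_val_in_Pos_iff[OF wff'(2)] by blast
      with c show False using body Pos_Neg_disjoint by blast
    qed
  next
    assume "subst (\<lambda>v. Var (\<rho> v)) (BAll x t \<psi>) \<in> Pos"
    then have B: "BAll x ?t' ?\<psi>' \<in> Pos" using subst_BAll by simp
    show "sat term_model (\<lambda>v. rep (\<rho> v)) (BAll x t \<psi>)"
      unfolding sat_BAll
    proof (intro allI impI)
      fix y assume y: "Atom PIn [Var (rep y), Var (val ?t')] \<in> Pos"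
      obtain b where b: "vEq b y \<in> Pos" "b \<notin> bv \<psi>" using Eq_class_avoid[of "bv \<psi>" y] by auto
      then have rep_b: "rep b = rep y" using rep_eq_iff by blast
      have "Atom PIn [Var b, ?t'] \<in> Pos" using In_val_in_Pos_iff[OF wff'(2)] rep_b y by simp
      with B have "Conj (Atom PIn [Var b, ?t']) (BAll x ?t' ?\<psi>') \<in> Pos"
        using wff' by (subst Conj_in_Pos_iff) auto
      then have "subst (Var(x := Var b)) ?\<psi>' \<in> Pos"
        using In_BAll_derives[OF wff' substble_rename] b(2) by (auto intro: Pos_derives)
      then show "sat term_model ((\<lambda>v. rep (\<rho> v))(x := rep y)) \<psi>" using body b(2) rep_b by metis
    qed
  qed
qed

text \<open>The truth lemma is stated for safely renamed formulas because in the quantifier cases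
  the bound variable is instantiated by representatives avoiding the bound variables.\<close>

lemma truth_lemma:
  "wff \<phi> \<Longrightarrow> safe_renaming \<phi> \<rho> \<Longrightarrow>
    sat term_model (\<lambda>v. rep (\<rho> v)) \<phi> \<longleftrightarrow> subst (\<lambda>v. Var (\<rho> v)) \<phi> \<in> Pos"
proof (induction \<phi> arbitrary: \<rho>)
  case (Conj \<phi> \<psi>)
  have "wff (subst (\<lambda>v. Var (\<rho> v)) (Conj \<phi> \<psi>))" using Conj.prems(1) by (intro fwf_subst) auto
  with Conj show ?case by (auto simp: Conj_in_Pos_iff safe_renaming_def)
next
  case (Disj \<phi> \<psi>)
  have "wff (subst (\<lambda>v. Var (\<rho> v)) (Disj \<phi> \<psi>))" using Disj.prems(1) by (intro fwf_subst) auto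
  with Disj show ?case by (auto simp: Disj_in_Pos_iff safe_renaming_def)
next
  case (Atom p ts)
  then show ?case by (intro truth_Atom) simp
next
  case (Ex x \<psi>)
  then have "wff \<psi>" by simp
  show ?case by (rule truth_Ex[OF \<open>wff \<psi>\<close> Ex.prems(2) Ex.IH[OF \<open>wff \<psi>\<close>]])
next
  case (BAll x t \<psi>)
  then have "wff \<psi>" "twf FA t" by simp_all
  show ?case by (rule truth_BAll[OF \<open>wff \<psi>\<close> \<open>twf FA t\<close> BAll.prems(2) BAll.IH[OF \<open>wff \<psi>\<close>]])
qed (simp_all add: Top_in_Pos Bot_notin_Pos)

end

context henkin_construction
begin

lemma Pos_exactly_one:
  assumes "(Top, Disj \<phi> \<psi>) \<in> logax FA PA" "(Conj \<phi> \<psi>, Bot) \<in> logax FA PA" "wff \<phi>" "wff \<psi>"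
  shows "\<psi> \<in> Pos \<longleftrightarrow> \<phi> \<notin> Pos"
proof -
  have "Disj \<phi> \<psi> \<in> Pos" using Pos_derives[OF Top_in_Pos derives_logax[OF assms(1)]] assms(3,4) by simp
  moreover have "\<not> (\<phi> \<in> Pos \<and> \<psi> \<in> Pos)"
    using Conj_in_Pos_iff[of \<phi> \<psi>] Pos_derives[OF _ derives_logax[OF assms(2)]] Bot_notin_Pos assms(3,4)
    by auto
  ultimately show ?thesis using Disj_in_Pos_iff[of \<phi> \<psi>] assms(3,4) by auto
qed

lemma admissible_term_model: "admissible FA term_model"
  unfolding admissible_def is_structure_def
proof (intro conjI ballI allI impI)
  show "dom term_model \<noteq> {}" by simp
  fix f as show "fint term_model f as \<in> dom term_model" by (simp add: val_def)
next
  fix a b assume "a \<in> dom term_model" "b \<in> dom term_model"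
  then obtain x y where "a = rep x" "b = rep y" by auto
  then have eq: "vEq a b \<in> Pos \<longleftrightarrow> a = b" using rep_eq_iff[of a b] rep_rep by simp
  then show "pint term_model PEq [a, b] \<longleftrightarrow> a = b" by simp
  show "pint term_model PNeq [a, b] \<longleftrightarrow> a \<noteq> b"
    using eq Pos_exactly_one[OF logax.P18 logax.P19] by simp
  show "pint term_model PNotin [a, b] \<longleftrightarrow> \<not> pint term_model PIn [a, b]"
    using Pos_exactly_one[OF logax.P16 logax.P17] by simp
qed

text \<open>Equality classes are infinite, so every valuation is realised by a renaming into variables
  avoiding a given finite set.\<close>

lemma assignment_as_renaming:
  assumes "assignment term_model e" "finite B"
  obtains \<rho> where "(\<lambda>v. rep (\<rho> v)) = e" "\<And>v. \<rho> v \<notin> B"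
proof -
  define \<rho> where "\<rho> v = (SOME b. vEq b (e v) \<in> Pos \<and> b \<notin> B)" for v
  have \<rho>: "vEq (\<rho> v) (e v) \<in> Pos \<and> \<rho> v \<notin> B" for v
    unfolding \<rho>_def using Eq_class_avoid[OF assms(2)] by (rule someI_ex)
  have "rep (\<rho> v) = e v" for v
  proof -
    obtain x where "e v = rep x" using assms(1) unfolding assignment_def by auto
    then show ?thesis using rep_eq_iff \<rho> rep_rep by metis
  qed
  with \<rho> show thesis by (intro that) auto
qed

lemma term_model_models_T: "c \<in> T \<Longrightarrow> models_cond term_model c"
  unfolding models_cond_def
proof (intro allI impI)
  fix e assume c: "c \<in> T" and e: "assignment term_model e" and sat: "sat term_model e (fst c)"
  obtain \<rho> where e_\<rho>: "(\<lambda>v. rep (\<rho> v)) = e" and \<rho>: "\<And>v. \<rho> v \<notin> bv (fst c) \<union> bv (snd c)"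
    using assignment_as_renaming[OF e, of "bv (fst c) \<union> bv (snd c)"] by auto
  have wff: "wff (fst c)" "wff (snd c)" using wff_T c by blast+
  have safe: "safe_renaming (fst c) \<rho>" "safe_renaming (snd c) \<rho>"
    unfolding safe_renaming_def using \<rho> by blast+
  have "subst (\<lambda>v. Var (\<rho> v)) (fst c) \<in> Pos" using truth_lemma[OF wff(1) safe(1)] sat e_\<rho> by simp
  moreover have "derives (subst (\<lambda>v. Var (\<rho> v)) (fst c)) (subst (\<lambda>v. Var (\<rho> v)) (snd c))"
    using c wff substble_safe_renaming[OF safe(1)] substble_safe_renaming[OF safe(2)]
    by (intro derives_instance) auto
  ultimately have "subst (\<lambda>v. Var (\<rho> v)) (snd c) \<in> Pos" by (rule Pos_derives)
  then show "sat term_model e (snd c)" using truth_lemma[OF wff(2) safe(2)] e_\<rho> by simp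
qed

lemma countermodel:
  "\<exists>M. admissible FA M \<and> (\<forall>c \<in> T. models_cond M c) \<and>
     (\<exists>e. assignment M e \<and> sat M e \<chi> \<and> \<not> sat M e \<chi>')"
proof (intro exI conjI)
  show "admissible FA term_model" by (rule admissible_term_model)
  show "\<forall>c\<in>T. models_cond term_model c" using term_model_models_T by blast
  show "assignment term_model rep" unfolding assignment_def by simp
  have sat_iff: "sat term_model rep \<phi> \<longleftrightarrow> \<phi> \<in> Pos" if "wff \<phi>" for \<phi>
    using truth_lemma[OF that, of "\<lambda>v. v"] by (simp add: safe_renaming_def)
  have "\<chi> \<in> Pos" "\<chi>' \<in> Neg" using stage_subset[of 0] by simp_all
  then show "sat term_model rep \<chi>" "\<not> sat term_model rep \<chi>'"
    using sat_iff wff_\<chi> wff_\<chi>' Pos_Neg_disjoint by auto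
qed

end

theorem mainTheorem2:
  fixes FA :: "'f::countable \<Rightarrow> nat" and PA :: "'p::countable \<Rightarrow> nat"
    and T :: "('f, 'p) cond set" and \<chi> \<chi>' :: "('f, 'p) fm"
  assumes "\<forall>c \<in> T. fwf FA PA (fst c) \<and> fwf FA PA (snd c)"
    and "fwf FA PA \<chi>" and "fwf FA PA \<chi>'"
  shows "fp_provable FA PA T \<chi> \<chi>' \<or>
         (\<exists>M. admissible FA M \<and> (\<forall>c \<in> T. models_cond M c) \<and>
              (\<exists>e. assignment M e \<and> sat M e \<chi> \<and> \<not> sat M e \<chi>'))"
proof (cases "positivistic_calculus.derives FA PA T \<chi> \<chi>'")
  case True
  then show ?thesis using positivistic_calculus.derives_fp_provable by blast
next
  case False
  then interpret henkin_construction FA PA T \<chi> \<chi>' using assms by unfold_locales auto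
  show ?thesis using countermodel by blast
qed

end
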